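(* Let $\alpha,\beta,\gamma,\delta\in\mathbb{R}$ with $\alpha+\delta\neq0$ and $\alpha\gamma=0$, and let $(G_7,g,J)$ be the connected three-dimensional non-unimodular Lie group with left-invariant Lorentzian metric $g$ whose Lie algebra has a pseudo-orthonormal basis $\{e_1,e_2,e_3\}$, $e_3$ timelike, with $$[e_1,e_2]=-\alpha e_1-\beta e_2-\beta e_3,\quad [e_1,e_3]=\alpha e_1+\beta e_2+\beta e_3,\quad [e_2,e_3]=\gamma e_1+\delta e_2+\delta e_3,$$ and with the product structure $J$ given by $Je_1=e_1$, $Je_2=e_2$, $Je_3=-e_3$. Then $(G_7,g,J)$ admits left-invariant Ricci collineations associated to the canonical connection $\nabla^0$ if and only if one of the following holds, and in each case the space $\mathbb{V}_{\mathbb{RC}}$ of these collineations is as indicated: (1) $\alpha=0$, $\delta\neq0$, $\gamma\neq0$, $\beta=0$, with $\mathbb{V}_{\mathbb{RC}}=\langle e_1\rangle$ (i.e. $\lambda_2=\lambda_3=0$); (2) $\alpha=0$, $\delta\neq0$, $\gamma=0$, with $\mathbb{V}_{\mathbb{RC}}=\langle e_1,e_2,e_3\rangle$; (3) $\alpha\neq0$, $\gamma=\delta=0$, with $\mathbb{V}_{\mathbb{RC}}=\langle e_2+e_3\rangle$ (i.e. $\lambda_1=0$, $\lambda_2=\lambda_3$).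
   Context: Pseudo-orthonormal with $e_3$ timelike means $g(e_1,e_1)=g(e_2,e_2)=1$, $g(e_3,e_3)=-1$, $g(e_i,e_j)=0$ for $i\ne j$. $J$ is extended left-invariantly to a $(1,1)$-tensor with $J^2=\mathrm{id}$. Let $\nabla$ be the Levi-Civita connection of $g$. The canonical connection is $$\nabla^0_XY=\nabla_XY-\tfrac12(\nabla_XJ)JY,$$ with curvature $R^0(X,Y)Z=\nabla^0_X\nabla^0_YZ-\nabla^0_Y\nabla^0_XZ-\nabla^0_{[X,Y]}Z$. Its Ricci tensor is $$\mathrm{Ric}^0(X,Y)=-g(R^0(X,e_1)Y,e_1)-g(R^0(X,e_2)Y,e_2)+g(R^0(X,e_3)Y,e_3),$$ and its symmetrization is $\widetilde{\mathrm{Ric}}^0(X,Y)=\frac12\big(\mathrm{Ric}^0(X,Y)+\mathrm{Ric}^0(Y,X)\big)$. For a left-invariant vector field $\xi=\lambda_1e_1+\lambda_2e_2+\lambda_3e_3$ ($\lambda_i\in\mathbb{R}$), $$(L_\xi\widetilde{\mathrm{Ric}}^0)(X,Y)=\xi\big(\widetilde{\mathrm{Ric}}^0(X,Y)\big)-\widetilde{\mathrm{Ric}}^0([\xi,X],Y)-\widetilde{\mathrm{Ric}}^0(X,[\xi,Y]).$$ A left-invariant Ricci collineation associated to $\nabla^0$ is a left-invariant $\xi$ with $L_\xi\widetilde{\mathrm{Ric}}^0=0$; $\mathbb{V}_{\mathbb{RC}}$ denotes the real vector space of all of them, and $\langle\cdot\rangle$ denotes linear span. The group admits left-invariant Ricci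 collineations if there is a nonzero such $\xi$. *)

theory Defs
  imports "HOL-Analysis.Analysis" "HOL-Library.Function_Algebras"
begin

section \<open>Smooth manifolds and Lie groups\<close>

text \<open>Smoothness on an \<^emph>\<open>open\<close> subset of a Euclidean space: all iterated directional
  derivatives exist and are (totally) differentiable.\<close>

fun Ck_on :: "nat \<Rightarrow> 'a::euclidean_space set \<Rightarrow> ('a \<Rightarrow> 'b::real_normed_vector) \<Rightarrow> bool" where
  "Ck_on 0 S f \<longleftrightarrow> continuous_on S f"
| "Ck_on (Suc k) S f \<longleftrightarrow>
     f differentiable_on S \<and> (\<forall>v. Ck_on k S (\<lambda>x. frechet_derivative f (at x) v))"

definition smooth_on :: "'a::euclidean_space set \<Rightarrow> ('a \<Rightarrow> 'b::real_normed_vector) \<Rightarrow> bool" where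
  "smooth_on S f \<longleftrightarrow> (\<forall>k. Ck_on k S f)"

text \<open>A chart is a pair of its domain and its coordinate map; the coordinate map is only
  relevant on the domain, and \<^term>\<open>inv_into U \<phi>\<close> is its inverse. The Euclidean space
  \<open>'m\<close> fixes the dimension of the manifold. Hausdorffness and second countability are
  type class constraints on \<open>'g\<close> in the theorem.\<close>

type_synonym ('g, 'm) atlas = "('g set \<times> ('g \<Rightarrow> 'm)) set"

definition smooth_atlas :: "('g::topological_space, 'm::euclidean_space) atlas \<Rightarrow> bool" where
  "smooth_atlas A \<longleftrightarrow>
     (\<forall>(U, \<phi>)\<in>A. open U \<and> open (\<phi> ` U) \<and> homeomorphism U (\<phi> ` U) \<phi> (inv_into U \<phi>)) \<and>
     (\<Union>(U, \<phi>)\<in>A. U) = UNIV \<and>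
     (\<forall>(U, \<phi>)\<in>A. \<forall>(V, \<psi>)\<in>A. smooth_on (\<phi> ` (U \<inter> V)) (\<psi> \<circ> inv_into U \<phi>))"

text \<open>The group is written additively, as is the convention for the type class
  \<^class>\<open>group_add\<close>, which does not assume commutativity.\<close>

definition lie_group :: "('g::topological_group_add, 'm::euclidean_space) atlas \<Rightarrow> bool" where
  "lie_group A \<longleftrightarrow> smooth_atlas A \<and>
     (\<forall>(U, \<phi>)\<in>A. \<forall>(V, \<psi>)\<in>A. \<forall>(W, \<theta>)\<in>A.
        smooth_on {(\<phi> x, \<psi> y) | x y. x \<in> U \<and> y \<in> V \<and> x + y \<in> W}
          (\<lambda>(u, v). \<theta> (inv_into U \<phi> u + inv_into V \<psi> v))) \<and>
     (\<forall>(U, \<phi>)\<in>A. \<forall>(V, \<psi>)\<in>A.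
        smooth_on {\<phi> x | x. x \<in> U \<and> - x \<in> V} (\<lambda>u. \<psi> (- inv_into U \<phi> u)))"

definition smooth_fun :: "('g, 'm::euclidean_space) atlas \<Rightarrow> ('g \<Rightarrow> real) \<Rightarrow> bool" where
  "smooth_fun A f \<longleftrightarrow> (\<forall>(U, \<phi>)\<in>A. smooth_on (\<phi> ` U) (f \<circ> inv_into U \<phi>))"


section \<open>Tangent vectors and vector fields\<close>

text \<open>A tangent vector at \<open>p\<close> is the functional on smooth functions that in each chart around
  \<open>p\<close> is a directional derivative; on non-smooth functions it is \<open>0\<close> by convention, so that
  equality of tangent vectors is equality of functionals. A vector field \<open>X\<close> assigns to \<open>p\<close> a
  tangent vector \<open>X p\<close>, and the function \<open>X(f)\<close> is \<open>\<lambda>p. X p f\<close>. Sums, differences and \<open>0\<close> of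
  these objects are the pointwise ones.\<close>

type_synonym 'g tvec = "('g \<Rightarrow> real) \<Rightarrow> real"
type_synonym 'g vfield = "'g \<Rightarrow> 'g tvec"

definition tangent_space :: "('g, 'm::euclidean_space) atlas \<Rightarrow> 'g \<Rightarrow> 'g tvec set" where
  "tangent_space A p = {v. \<forall>(U, \<phi>)\<in>A. p \<in> U \<longrightarrow>
     (\<exists>w. v = (\<lambda>f. if smooth_fun A f
                   then frechet_derivative (f \<circ> inv_into U \<phi>) (at (\<phi> p)) w else 0))}"

definition tscale :: "real \<Rightarrow> 'g tvec \<Rightarrow> 'g tvec" where
  "tscale c v = (\<lambda>f. c * v f)"

definition vector_fields :: "('g, 'm::euclidean_space) atlas \<Rightarrow> 'g vfield set" where
  "vector_fields A = {X. (\<forall>p. X p \<in> tangent_space A p) \<and>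
     (\<forall>f. smooth_fun A f \<longrightarrow> smooth_fun A (\<lambda>p. X p f))}"

definition fscale :: "('g \<Rightarrow> real) \<Rightarrow> 'g vfield \<Rightarrow> 'g vfield" where
  "fscale h X = (\<lambda>p. tscale (h p) (X p))"

definition vscale :: "real \<Rightarrow> 'g vfield \<Rightarrow> 'g vfield" (infixr "\<odot>" 75) where
  "c \<odot> X = fscale (\<lambda>_. c) X"

interpretation vfield: vector_space vscale
  by standard (simp_all add: vscale_def fscale_def tscale_def fun_eq_iff algebra_simps)

definition lie_bracket :: "'g vfield \<Rightarrow> 'g vfield \<Rightarrow> 'g vfield" where
  "lie_bracket X Y = (\<lambda>p f. X p (\<lambda>q. Y q f) - Y p (\<lambda>q. X q f))"

text \<open>The differential of the left translation by \<open>a\<close>, mapping the tangent space at \<open>p\<close> to the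
  one at \<open>a + p\<close>.\<close>

definition dL :: "'g::plus \<Rightarrow> 'g tvec \<Rightarrow> 'g tvec" where
  "dL a v = (\<lambda>f. v (\<lambda>x. f (a + x)))"

definition left_invariant_fields :: "('g::plus, 'm::euclidean_space) atlas \<Rightarrow> 'g vfield set" where
  "left_invariant_fields A = {X \<in> vector_fields A. \<forall>a p. X (a + p) = dL a (X p)}"


section \<open>Left-invariant Lorentzian metrics and product structures\<close>

definition on_fields :: "('g \<Rightarrow> 'g tvec \<Rightarrow> 'g tvec \<Rightarrow> real) \<Rightarrow> 'g vfield \<Rightarrow> 'g vfield \<Rightarrow> 'g \<Rightarrow> real" where
  "on_fields g X Y = (\<lambda>p. g p (X p) (Y p))"

text \<open>The fourth clause says that the form at \<open>p\<close> is nondegenerate of index one: it is negative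
  on some line and positive definite on the orthogonal complement of that line. In the last
  clause, smoothness of a tensor field is tested on smooth vector fields.\<close>

definition lorentzian_metric ::
    "('g, 'm::euclidean_space) atlas \<Rightarrow> ('g \<Rightarrow> 'g tvec \<Rightarrow> 'g tvec \<Rightarrow> real) \<Rightarrow> bool" where
  "lorentzian_metric A g \<longleftrightarrow>
     (\<forall>p. \<forall>u\<in>tangent_space A p. \<forall>v\<in>tangent_space A p. g p u v = g p v u) \<and>
     (\<forall>p. \<forall>u\<in>tangent_space A p. \<forall>v\<in>tangent_space A p. \<forall>w\<in>tangent_space A p.
        g p (u + v) w = g p u w + g p v w) \<and>
     (\<forall>p c. \<forall>u\<in>tangent_space A p. \<forall>v\<in>tangent_space A p. g p (tscale c u) v = c * g p u v) \<and>
     (\<forall>p. \<exists>t\<in>tangent_space A p. g p t t < 0 \<and>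
        (\<forall>u\<in>tangent_space A p. g p t u = 0 \<and> u \<noteq> 0 \<longrightarrow> g p u u > 0)) \<and>
     (\<forall>X\<in>vector_fields A. \<forall>Y\<in>vector_fields A. smooth_fun A (on_fields g X Y))"

definition left_invariant_metric ::
    "('g::plus, 'm::euclidean_space) atlas \<Rightarrow> ('g \<Rightarrow> 'g tvec \<Rightarrow> 'g tvec \<Rightarrow> real) \<Rightarrow> bool" where
  "left_invariant_metric A g \<longleftrightarrow>
     (\<forall>a p. \<forall>u\<in>tangent_space A p. \<forall>v\<in>tangent_space A p. g (a + p) (dL a u) (dL a v) = g p u v)"

definition apply_field :: "('g \<Rightarrow> 'g tvec \<Rightarrow> 'g tvec) \<Rightarrow> 'g vfield \<Rightarrow> 'g vfield" where
  "apply_field J X = (\<lambda>p. J p (X p))"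

definition product_structure ::
    "('g, 'm::euclidean_space) atlas \<Rightarrow> ('g \<Rightarrow> 'g tvec \<Rightarrow> 'g tvec) \<Rightarrow> bool" where
  "product_structure A J \<longleftrightarrow>
     (\<forall>p. \<forall>u\<in>tangent_space A p. J p u \<in> tangent_space A p \<and> J p (J p u) = u) \<and>
     (\<forall>p. \<forall>u\<in>tangent_space A p. \<forall>v\<in>tangent_space A p. J p (u + v) = J p u + J p v) \<and>
     (\<forall>p c. \<forall>u\<in>tangent_space A p. J p (tscale c u) = tscale c (J p u)) \<and>
     (\<forall>X\<in>vector_fields A. apply_field J X \<in> vector_fields A)"

definition left_invariant_endo ::
    "('g::plus, 'm::euclidean_space) atlas \<Rightarrow> ('g \<Rightarrow> 'g tvec \<Rightarrow> 'g tvec) \<Rightarrow> bool" where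
  "left_invariant_endo A J \<longleftrightarrow>
     (\<forall>a p. \<forall>u\<in>tangent_space A p. J (a + p) (dL a u) = dL a (J p u))"

definition lie_algebra_basis ::
    "('g::plus, 'm::euclidean_space) atlas \<Rightarrow> 'g vfield \<Rightarrow> 'g vfield \<Rightarrow> 'g vfield \<Rightarrow> bool" where
  "lie_algebra_basis A e1 e2 e3 \<longleftrightarrow> distinct [e1, e2, e3] \<and>
     vfield.independent {e1, e2, e3} \<and> vfield.span {e1, e2, e3} = left_invariant_fields A"

text \<open>The third vector field is the timelike one.\<close>

definition pseudo_orthonormal ::
    "('g \<Rightarrow> 'g tvec \<Rightarrow> 'g tvec \<Rightarrow> real) \<Rightarrow> 'g vfield \<Rightarrow> 'g vfield \<Rightarrow> 'g vfield \<Rightarrow> bool" where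
  "pseudo_orthonormal g e1 e2 e3 \<longleftrightarrow> (\<forall>p.
     on_fields g e1 e1 p = 1 \<and> on_fields g e2 e2 p = 1 \<and> on_fields g e3 e3 p = - 1 \<and>
     on_fields g e1 e2 p = 0 \<and> on_fields g e1 e3 p = 0 \<and> on_fields g e2 e3 p = 0)"


section \<open>Connections, curvature and Ricci collineations\<close>

definition affine_connection ::
    "('g, 'm::euclidean_space) atlas \<Rightarrow> ('g vfield \<Rightarrow> 'g vfield \<Rightarrow> 'g vfield) \<Rightarrow> bool" where
  "affine_connection A D \<longleftrightarrow>
     (\<forall>X\<in>vector_fields A. \<forall>Y\<in>vector_fields A. D X Y \<in> vector_fields A) \<and>
     (\<forall>X\<in>vector_fields A. \<forall>X'\<in>vector_fields A. \<forall>Y\<in>vector_fields A.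
        D (X + X') Y = D X Y + D X' Y \<and> D Y (X + X') = D Y X + D Y X') \<and>
     (\<forall>h. \<forall>X\<in>vector_fields A. \<forall>Y\<in>vector_fields A. smooth_fun A h \<longrightarrow>
        D (fscale h X) Y = fscale h (D X Y) \<and>
        D X (fscale h Y) = fscale h (D X Y) + fscale (\<lambda>p. X p h) Y)"

definition levi_civita ::
    "('g, 'm::euclidean_space) atlas \<Rightarrow> ('g \<Rightarrow> 'g tvec \<Rightarrow> 'g tvec \<Rightarrow> real) \<Rightarrow>
     ('g vfield \<Rightarrow> 'g vfield \<Rightarrow> 'g vfield) \<Rightarrow> bool" where
  "levi_civita A g D \<longleftrightarrow> affine_connection A D \<and>
     (\<forall>X\<in>vector_fields A. \<forall>Y\<in>vector_fields A. D X Y - D Y X = lie_bracket X Y) \<and>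
     (\<forall>X\<in>vector_fields A. \<forall>Y\<in>vector_fields A. \<forall>Z\<in>vector_fields A. \<forall>p.
        X p (on_fields g Y Z) = on_fields g (D X Y) Z p + on_fields g Y (D X Z) p)"

text \<open>\<open>(D\<^sub>X J) Y\<close>\<close>

definition deriv_endo :: "('g vfield \<Rightarrow> 'g vfield \<Rightarrow> 'g vfield) \<Rightarrow> ('g \<Rightarrow> 'g tvec \<Rightarrow> 'g tvec) \<Rightarrow>
    'g vfield \<Rightarrow> 'g vfield \<Rightarrow> 'g vfield" where
  "deriv_endo D J X Y = D X (apply_field J Y) - apply_field J (D X Y)"

definition canonical_connection ::
    "('g vfield \<Rightarrow> 'g vfield \<Rightarrow> 'g vfield) \<Rightarrow> ('g \<Rightarrow> 'g tvec \<Rightarrow> 'g tvec) \<Rightarrow>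
     'g vfield \<Rightarrow> 'g vfield \<Rightarrow> 'g vfield" where
  "canonical_connection D J X Y = D X Y - (1/2) \<odot> deriv_endo D J X (apply_field J Y)"

definition curvature :: "('g vfield \<Rightarrow> 'g vfield \<Rightarrow> 'g vfield) \<Rightarrow>
    'g vfield \<Rightarrow> 'g vfield \<Rightarrow> 'g vfield \<Rightarrow> 'g vfield" where
  "curvature D X Y Z = D X (D Y Z) - D Y (D X Z) - D (lie_bracket X Y) Z"

text \<open>The vector fields \<open>e1\<close>, \<open>e2\<close>, \<open>e3\<close> are meant to be a pseudo-orthonormal frame with
  \<open>e3\<close> timelike.\<close>

definition ricci :: "('g \<Rightarrow> 'g tvec \<Rightarrow> 'g tvec \<Rightarrow> real) \<Rightarrow> ('g vfield \<Rightarrow> 'g vfield \<Rightarrow> 'g vfield) \<Rightarrow>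
    'g vfield \<Rightarrow> 'g vfield \<Rightarrow> 'g vfield \<Rightarrow> 'g vfield \<Rightarrow> 'g vfield \<Rightarrow> 'g \<Rightarrow> real" where
  "ricci g D e1 e2 e3 X Y = (\<lambda>p.
     - on_fields g (curvature D X e1 Y) e1 p - on_fields g (curvature D X e2 Y) e2 p
     + on_fields g (curvature D X e3 Y) e3 p)"

definition symmetrization :: "('g vfield \<Rightarrow> 'g vfield \<Rightarrow> 'g \<Rightarrow> real) \<Rightarrow>
    'g vfield \<Rightarrow> 'g vfield \<Rightarrow> 'g \<Rightarrow> real" where
  "symmetrization T X Y = (\<lambda>p. (T X Y p + T Y X p) / 2)"

definition lie_derivative :: "'g vfield \<Rightarrow> ('g vfield \<Rightarrow> 'g vfield \<Rightarrow> 'g \<Rightarrow> real) \<Rightarrow>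
    'g vfield \<Rightarrow> 'g vfield \<Rightarrow> 'g \<Rightarrow> real" where
  "lie_derivative \<xi> T X Y = (\<lambda>p.
     \<xi> p (T X Y) - T (lie_bracket \<xi> X) Y p - T X (lie_bracket \<xi> Y) p)"

definition ricci_collineations ::
    "('g::plus, 'm::euclidean_space) atlas \<Rightarrow> ('g \<Rightarrow> 'g tvec \<Rightarrow> 'g tvec \<Rightarrow> real) \<Rightarrow>
     ('g vfield \<Rightarrow> 'g vfield \<Rightarrow> 'g vfield) \<Rightarrow> 'g vfield \<Rightarrow> 'g vfield \<Rightarrow> 'g vfield \<Rightarrow> 'g vfield set" where
  "ricci_collineations A g D e1 e2 e3 = {\<xi> \<in> left_invariant_fields A.
     \<forall>X\<in>vector_fields A. \<forall>Y\<in>vector_fields A. \<forall>p.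
       lie_derivative \<xi> (symmetrization (ricci g D e1 e2 e3)) X Y p = 0}"

end

theory Submission
  imports Defs
begin

text \<open>
  Since \<open>J\<close> is parallel for the canonical connection, \<open>\<nabla>\<^sup>0\<close> is obtained from \<open>\<nabla>\<close> by projecting onto
  the eigenspaces \<open>\<langle>e1, e2\<rangle>\<close> and \<open>\<langle>e3\<rangle>\<close> of \<open>J\<close>. As it is also metric, it is determined by the one-form
  \<open>\<omega>(X) = g(\<nabla>\<^sub>X e1, e2)\<close>, and its curvature by \<open>d\<omega>\<close>, called \<open>Omega\<close> below. The Koszul formula gives
  \<open>\<omega>(e1) = \<alpha>\<close>, \<open>\<omega>(e2) = \<beta>\<close>, \<open>\<omega>(e3) = \<gamma>/2 - \<beta>\<close>, whence the symmetrized Ricci tensor. Its Lie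
  derivative is again a tensor, so it vanishes on all vector fields iff it vanishes on the frame,
  which is a system of polynomial equations in the coefficients of \<open>\<xi>\<close>.
\<close>

section \<open>Smooth functions and vector fields\<close>

lemma Ck_on_cong:
  assumes "open S" "\<And>x. x \<in> S \<Longrightarrow> f x = h x"
  shows "Ck_on k S f = Ck_on k S h"
  using assms(2)
proof (induction k arbitrary: f h)
  case 0
  then show ?case by (simp cong: continuous_on_cong)
next
  case (Suc k)
  \<comment> \<open>Derivatives \<open>at x\<close> look at a full neighbourhood of
    \<open>x\<close>, so agreement on \<open>S\<close> determines them because \<open>S\<close> is
    open. This is what later replaces the derivative of a sum or product by its formula, which holds
    on \<open>S\<close> only.\<close>
  have D: "(f has_derivative F) (at x) \<longleftrightarrow> (h has_derivative F) (at x)" if "x \<in> S" for F x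
    using has_derivative_transform_within_open[OF _ assms(1) that] Suc.prems by metis
  have "f differentiable_on S \<longleftrightarrow> h differentiable_on S"
    unfolding differentiable_on_eq_differentiable_at[OF assms(1)] differentiable_def
    using D by blast
  moreover have "frechet_derivative f (at x) = frechet_derivative h (at x)" if "x \<in> S" for x
    using D[OF that] by (simp add: frechet_derivative_def)
  ultimately show ?case
    using Suc.IH[of "\<lambda>x. frechet_derivative f (at x) v" "\<lambda>x. frechet_derivative h (at x) v" for v]
    by simp
qed

lemma Ck_on_Suc_imp: "Ck_on (Suc k) S f \<Longrightarrow> Ck_on k S f"
proof (induction k arbitrary: f)
  case 0
  then show ?case by (simp add: differentiable_imp_continuous_on)
next
  case (Suc k)
  then show ?case by (metis Ck_on.simps(2))
qed

lemma Ck_on_const: "Ck_on k S (\<lambda>x. c)"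
proof (induction k arbitrary: c)
  case (Suc k)
  then show ?case by (simp add: frechet_derivative_const)
qed simp

lemma Ck_on_differentiable_at:
  assumes "open S" "Ck_on (Suc k) S f" "x \<in> S"
  shows "f differentiable (at x)"
  using assms by (auto simp: differentiable_on_eq_differentiable_at)

lemma frechet_derivative_mult:
  fixes f h :: "'a::real_normed_vector \<Rightarrow> 'b::real_normed_algebra"
  assumes "f differentiable (at x)" "h differentiable (at x)"
  shows "frechet_derivative (\<lambda>x. f x * h x) (at x) =
    (\<lambda>v. f x * frechet_derivative h (at x) v + frechet_derivative f (at x) v * h x)"
  using assms
  by (intro frechet_derivative_at[symmetric] has_derivative_mult)
     (auto simp: frechet_derivative_works)

lemma frechet_derivative_add:
  assumes "f differentiable (at x)" "h differentiable (at x)"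
  shows "frechet_derivative (\<lambda>x. f x + h x) (at x) =
    (\<lambda>v. frechet_derivative f (at x) v + frechet_derivative h (at x) v)"
  using assms
  by (intro frechet_derivative_at[symmetric] has_derivative_add)
     (auto simp: frechet_derivative_works)

lemma Ck_on_add:
  assumes "open S" "Ck_on k S f" "Ck_on k S h"
  shows "Ck_on k S (\<lambda>x. f x + h x)"
  using assms(2,3)
proof (induction k arbitrary: f h)
  case 0
  then show ?case by (simp add: continuous_on_add)
next
  case (Suc k)
  have "Ck_on k S (\<lambda>x. frechet_derivative (\<lambda>x. f x + h x) (at x) v)" for v
  proof -
    have "Ck_on k S (\<lambda>x. frechet_derivative f (at x) v + frechet_derivative h (at x) v)"
      using Suc by simp
    then show ?thesis
      by (subst Ck_on_cong[OF assms(1)])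
         (auto simp: frechet_derivative_add Ck_on_differentiable_at[OF assms(1) Suc.prems(1)]
            Ck_on_differentiable_at[OF assms(1) Suc.prems(2)])
  qed
  then show ?case using Suc.prems by (simp add: differentiable_on_add)
qed

text \<open>By the Leibniz rule the derivative is a sum of products of a factor with a derivative of
  the other. The factor is differentiable one order further than the induction hypothesis asks for,
  hence the descent by \<open>Ck_on_Suc_imp\<close>.\<close>

lemma Ck_on_mult:
  fixes f h :: "'a::euclidean_space \<Rightarrow> 'b::real_normed_algebra"
  assumes "open S" "Ck_on k S f" "Ck_on k S h"
  shows "Ck_on k S (\<lambda>x. f x * h x)"
  using assms(2,3)
proof (induction k arbitrary: f h)
  case 0
  then show ?case by (simp add: continuous_on_mult)
next
  case (Suc k)
  have "Ck_on k S (\<lambda>x. frechet_derivative (\<lambda>x. f x * h x) (at x) v)" for v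
  proof -
    have "Ck_on k S (\<lambda>x. f x * frechet_derivative h (at x) v)"
      using Suc.prems Suc.IH[of f "\<lambda>x. frechet_derivative h (at x) v"] Ck_on_Suc_imp by auto
    moreover have "Ck_on k S (\<lambda>x. frechet_derivative f (at x) v * h x)"
      using Suc.prems Suc.IH[of "\<lambda>x. frechet_derivative f (at x) v" h] Ck_on_Suc_imp by auto
    ultimately have "Ck_on k S (\<lambda>x. f x * frechet_derivative h (at x) v
        + frechet_derivative f (at x) v * h x)"
      by (rule Ck_on_add[OF assms(1)])
    then show ?thesis
      by (subst Ck_on_cong[OF assms(1)])
         (auto simp: frechet_derivative_mult Ck_on_differentiable_at[OF assms(1) Suc.prems(1)]
            Ck_on_differentiable_at[OF assms(1) Suc.prems(2)])
  qed
  then show ?case using Suc.prems by (auto simp: differentiable_on_eq_differentiable_at[OF assms(1)])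
qed

section \<open>Tangent vectors and vector fields as derivations\<close>

locale smooth_manifold =
  fixes A :: "('g::topological_space, 'm::euclidean_space) atlas"
  assumes atlas: "smooth_atlas A"
begin

lemma chart_at:
  obtains U \<phi> where "(U, \<phi>) \<in> A" "p \<in> U"
  using atlas UNIV_I[of p] unfolding smooth_atlas_def by blast

lemma open_chart_image: "(U, \<phi>) \<in> A \<Longrightarrow> open (\<phi> ` U)"
  using atlas unfolding smooth_atlas_def by blast

lemma inv_into_chart: "(U, \<phi>) \<in> A \<Longrightarrow> p \<in> U \<Longrightarrow> inv_into U \<phi> (\<phi> p) = p"
  using atlas unfolding smooth_atlas_def homeomorphism_def by blast

lemma smooth_fun_const [simp]: "smooth_fun A (\<lambda>_. c)"
  by (auto simp: smooth_fun_def smooth_on_def comp_def Ck_on_const)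

lemma smooth_fun_add [simp]:
  "smooth_fun A f \<Longrightarrow> smooth_fun A h \<Longrightarrow> smooth_fun A (\<lambda>p. f p + h p)"
  unfolding smooth_fun_def smooth_on_def comp_def
  by (fast intro: Ck_on_add open_chart_image)

lemma smooth_fun_mult [simp]:
  "smooth_fun A f \<Longrightarrow> smooth_fun A h \<Longrightarrow> smooth_fun A (\<lambda>p. f p * h p)"
  unfolding smooth_fun_def smooth_on_def comp_def
  by (fast intro: Ck_on_mult open_chart_image)

lemma smooth_fun_minus [simp]: "smooth_fun A f \<Longrightarrow> smooth_fun A (\<lambda>p. - f p)"
  using smooth_fun_mult[of "\<lambda>_. -1" f] by simp

lemma smooth_fun_diff [simp]:
  "smooth_fun A f \<Longrightarrow> smooth_fun A h \<Longrightarrow> smooth_fun A (\<lambda>p. f p - h p)"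
  using smooth_fun_add[of f "\<lambda>p. - h p"] by simp

lemma smooth_fun_differentiable:
  assumes "smooth_fun A f" "(U, \<phi>) \<in> A" "p \<in> U"
  shows "(f \<circ> inv_into U \<phi>) differentiable (at (\<phi> p))"
proof -
  have "Ck_on (Suc 0) (\<phi> ` U) (f \<circ> inv_into U \<phi>)"
    using assms(1,2) unfolding smooth_fun_def smooth_on_def by blast
  then show ?thesis
    by (rule Ck_on_differentiable_at[OF open_chart_image[OF assms(2)]]) (use assms in auto)
qed

text \<open>Separates out the functional inside \<open>tangent_space\<close>, so that its linear
  dependence on the coordinate vector \<open>w\<close> can be stated. For non-smooth functions
  linearity is trivial, as the value is 0 by convention.\<close>

definition chart_tvec :: "'g set \<Rightarrow> ('g \<Rightarrow> 'm) \<Rightarrow> 'g \<Rightarrow> 'm \<Rightarrow> 'g tvec" where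
  "chart_tvec U \<phi> p w = (\<lambda>f. if smooth_fun A f
     then frechet_derivative (f \<circ> inv_into U \<phi>) (at (\<phi> p)) w else 0)"

lemma tangent_space_iff:
  "v \<in> tangent_space A p \<longleftrightarrow>
    (\<forall>U \<phi>. (U, \<phi>) \<in> A \<longrightarrow> p \<in> U \<longrightarrow> (\<exists>w. v = chart_tvec U \<phi> p w))"
  by (auto simp add: tangent_space_def chart_tvec_def)

lemma tangent_chart_tvec:
  assumes "v \<in> tangent_space A p" "(U, \<phi>) \<in> A" "p \<in> U"
  obtains w where "v = chart_tvec U \<phi> p w"
  using assms unfolding tangent_space_iff by blast

lemma chart_tvec_add:
  assumes "(U, \<phi>) \<in> A" "p \<in> U"
  shows "chart_tvec U \<phi> p (v + w) = chart_tvec U \<phi> p v + chart_tvec U \<phi> p w"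
  using linear_add[OF linear_frechet_derivative[OF smooth_fun_differentiable[OF _ assms]]]
  by (simp add: chart_tvec_def fun_eq_iff)

lemma chart_tvec_scale:
  assumes "(U, \<phi>) \<in> A" "p \<in> U"
  shows "chart_tvec U \<phi> p (c *\<^sub>R w) = tscale c (chart_tvec U \<phi> p w)"
  using linear_scale[OF linear_frechet_derivative[OF smooth_fun_differentiable[OF _ assms]]]
  by (simp add: chart_tvec_def tscale_def fun_eq_iff)

text \<open>A tangent vector must have a coordinate vector in every chart around \<open>p\<close>;
  in each of them the coordinate vectors of the summands add up.\<close>

lemma tangent_space_add [simp]:
  assumes "u \<in> tangent_space A p" "v \<in> tangent_space A p"
  shows "u + v \<in> tangent_space A p"
  unfolding tangent_space_iff
proof clarify
  fix U \<phi> assume U: "(U, \<phi>) \<in> A" "p \<in> U"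
  obtain w w' where "u = chart_tvec U \<phi> p w" "v = chart_tvec U \<phi> p w'"
    using tangent_chart_tvec[OF assms(1) U] tangent_chart_tvec[OF assms(2) U] by metis
  then have "u + v = chart_tvec U \<phi> p (w + w')"
    by (simp add: chart_tvec_add[OF U])
  then show "\<exists>w. u + v = chart_tvec U \<phi> p w" ..
qed

lemma tangent_space_scale [simp]:
  assumes "u \<in> tangent_space A p"
  shows "tscale c u \<in> tangent_space A p"
  unfolding tangent_space_iff
proof clarify
  fix U \<phi> assume U: "(U, \<phi>) \<in> A" "p \<in> U"
  obtain w where "u = chart_tvec U \<phi> p w"
    by (rule tangent_chart_tvec[OF assms U])
  then have "tscale c u = chart_tvec U \<phi> p (c *\<^sub>R w)"
    by (simp add: chart_tvec_scale[OF U])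
  then show "\<exists>w. tscale c u = chart_tvec U \<phi> p w" ..
qed

lemma tangent_const:
  assumes "v \<in> tangent_space A p"
  shows "v (\<lambda>_. c) = 0"
proof -
  obtain U \<phi> where U: "(U, \<phi>) \<in> A" "p \<in> U" by (rule chart_at)
  obtain w where "v = chart_tvec U \<phi> p w"
    by (rule tangent_chart_tvec[OF assms(1) U])
  then show ?thesis
    by (simp add: chart_tvec_def comp_def frechet_derivative_const)
qed

lemma tangent_add:
  assumes "v \<in> tangent_space A p" "smooth_fun A f" "smooth_fun A h"
  shows "v (\<lambda>q. f q + h q) = v f + v h"
proof -
  obtain U \<phi> where U: "(U, \<phi>) \<in> A" "p \<in> U" by (rule chart_at)
  obtain w where "v = chart_tvec U \<phi> p w"
    by (rule tangent_chart_tvec[OF assms(1) U])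
  then show ?thesis
    using smooth_fun_differentiable[OF assms(2) U] smooth_fun_differentiable[OF assms(3) U] assms
    by (simp add: chart_tvec_def comp_def frechet_derivative_add)
qed

lemma tangent_mult:
  assumes "v \<in> tangent_space A p" "smooth_fun A f" "smooth_fun A h"
  shows "v (\<lambda>q. f q * h q) = f p * v h + v f * h p"
proof -
  obtain U \<phi> where U: "(U, \<phi>) \<in> A" "p \<in> U" by (rule chart_at)
  obtain w where "v = chart_tvec U \<phi> p w"
    by (rule tangent_chart_tvec[OF assms(1) U])
  then show ?thesis
    using smooth_fun_differentiable[OF assms(2) U] smooth_fun_differentiable[OF assms(3) U] assms
    by (simp add: chart_tvec_def comp_def frechet_derivative_mult inv_into_chart[OF U])
qed

lemma field_tangent [simp]: "X \<in> vector_fields A \<Longrightarrow> X p \<in> tangent_space A p"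
  by (simp add: vector_fields_def)

lemma smooth_fun_field:
  "X \<in> vector_fields A \<Longrightarrow> smooth_fun A f \<Longrightarrow> smooth_fun A (\<lambda>p. X p f)"
  unfolding vector_fields_def by blast

lemma vector_fieldsI:
  assumes "\<And>p. X p \<in> tangent_space A p"
    and "\<And>f. smooth_fun A f \<Longrightarrow> smooth_fun A (\<lambda>p. X p f)"
  shows "X \<in> vector_fields A"
  using assms unfolding vector_fields_def by blast

lemma vector_fields_add [simp]:
  "X \<in> vector_fields A \<Longrightarrow> Y \<in> vector_fields A \<Longrightarrow> X + Y \<in> vector_fields A"
  by (rule vector_fieldsI) (simp_all add: smooth_fun_field[of X] smooth_fun_field[of Y])

lemma vector_fields_fscale [simp]:
  "smooth_fun A h \<Longrightarrow> X \<in> vector_fields A \<Longrightarrow> fscale h X \<in> vector_fields A"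
  unfolding fscale_def
  by (rule vector_fieldsI) (simp_all add: smooth_fun_field[of X], simp add: tscale_def smooth_fun_field[of X])

lemma vector_fields_vscale [simp]: "X \<in> vector_fields A \<Longrightarrow> c \<odot> X \<in> vector_fields A"
  by (simp add: vscale_def)

lemma vector_fields_minus [simp]: "X \<in> vector_fields A \<Longrightarrow> - X \<in> vector_fields A"
  using vector_fields_vscale[of X "-1"] by simp

lemma vector_fields_diff [simp]:
  "X \<in> vector_fields A \<Longrightarrow> Y \<in> vector_fields A \<Longrightarrow> X - Y \<in> vector_fields A"
  using vector_fields_add[of X "- Y"] by simp

text \<open>Vector fields are compared as functionals on all functions, so identities between
  brackets also have to be checked on non-smooth ones.\<close>

lemma field_nonsmooth: "X \<in> vector_fields A \<Longrightarrow> \<not> smooth_fun A f \<Longrightarrow> X p f = 0"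
proof -
  assume X: "X \<in> vector_fields A" and f: "\<not> smooth_fun A f"
  obtain U \<phi> where U: "(U, \<phi>) \<in> A" "p \<in> U" by (rule chart_at)
  obtain w where "X p = chart_tvec U \<phi> p w"
    by (rule tangent_chart_tvec[OF field_tangent[OF X] U])
  then show "X p f = 0" using f by (simp add: chart_tvec_def)
qed

lemma field_const [simp]: "X \<in> vector_fields A \<Longrightarrow> X p (\<lambda>_. c) = 0"
  by (rule tangent_const[OF field_tangent])

lemma field_add:
  "X \<in> vector_fields A \<Longrightarrow> smooth_fun A f \<Longrightarrow> smooth_fun A h \<Longrightarrow> X p (\<lambda>q. f q + h q) = X p f + X p h"
  by (rule tangent_add[OF field_tangent])

lemma field_mult:
  "X \<in> vector_fields A \<Longrightarrow> smooth_fun A f \<Longrightarrow> smooth_fun A h \<Longrightarrow>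
    X p (\<lambda>q. f q * h q) = f p * X p h + X p f * h p"
  by (rule tangent_mult[OF field_tangent])

lemma field_cmult:
  "X \<in> vector_fields A \<Longrightarrow> smooth_fun A h \<Longrightarrow> X p (\<lambda>q. c * h q) = c * X p h"
  using field_mult[of X "\<lambda>_. c" h p] by simp

section \<open>Brackets, tensors and connections\<close>

text \<open>For smooth \<open>f\<close> this is additivity of \<open>Y\<close> as a derivation. For
  other \<open>f\<close> the inner functions of the brackets are constantly 0, and a field kills
  constants.\<close>

lemma lie_bracket_add_left:
  assumes "X \<in> vector_fields A" "X' \<in> vector_fields A" "Y \<in> vector_fields A"
  shows "lie_bracket (X + X') Y = lie_bracket X Y + lie_bracket X' Y"
proof (intro ext)
  fix p f
  show "lie_bracket (X + X') Y p f = (lie_bracket X Y + lie_bracket X' Y) p f"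
    by (cases "smooth_fun A f")
       (use assms in \<open>simp_all add: lie_bracket_def field_add[of Y] field_nonsmooth[of X]
          field_nonsmooth[of X'] field_nonsmooth[of Y]
          smooth_fun_field[of X] smooth_fun_field[of X']\<close>)
qed

lemma lie_bracket_swap: "lie_bracket X Y = - lie_bracket Y X"
  by (simp add: lie_bracket_def fun_eq_iff)

lemma lie_bracket_self [simp]: "lie_bracket X X = 0"
  by (simp add: lie_bracket_def fun_eq_iff)

lemma lie_bracket_fscale_left:
  assumes "X \<in> vector_fields A" "Y \<in> vector_fields A" "smooth_fun A h"
  shows "lie_bracket (fscale h X) Y = fscale h (lie_bracket X Y) - fscale (\<lambda>p. Y p h) X"
proof (intro ext)
  fix p f
  show "lie_bracket (fscale h X) Y p f = (fscale h (lie_bracket X Y) - fscale (\<lambda>p. Y p h) X) p f"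
    by (cases "smooth_fun A f")
       (use assms in \<open>simp_all add: lie_bracket_def field_mult[of Y] field_nonsmooth[of X] field_nonsmooth[of Y]
          smooth_fun_field[of X] fscale_def tscale_def algebra_simps\<close>)
qed

lemma lie_bracket_add_right:
  assumes "X \<in> vector_fields A" "X' \<in> vector_fields A" "Y \<in> vector_fields A"
  shows "lie_bracket Y (X + X') = lie_bracket Y X + lie_bracket Y X'"
  using lie_bracket_add_left[OF assms] lie_bracket_swap[of Y] by simp

lemma lie_bracket_fscale_right:
  assumes "X \<in> vector_fields A" "Y \<in> vector_fields A" "smooth_fun A h"
  shows "lie_bracket Y (fscale h X) = fscale h (lie_bracket Y X) + fscale (\<lambda>p. Y p h) X"
  using lie_bracket_fscale_left[OF assms] lie_bracket_swap[of Y]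
  by (simp add: fun_eq_iff fscale_def tscale_def)

lemma lie_bracket_vscale_left:
  assumes "X \<in> vector_fields A" "Y \<in> vector_fields A"
  shows "lie_bracket (c \<odot> X) Y = c \<odot> lie_bracket X Y"
  using lie_bracket_fscale_left[OF assms, of "\<lambda>_. c"] assms
  by (simp add: vscale_def) (simp add: fun_eq_iff fscale_def tscale_def)

text \<open>A covariant 2-tensor, described as a form bilinear over the smooth functions. The
  arguments are whole fields, not vectors at a point, because \<open>ricci\<close> and
  \<open>lie_derivative\<close> involve derivatives of their arguments, and that they depend on
  values only is what has to be proved.\<close>

definition tensor2 :: "('g vfield \<Rightarrow> 'g vfield \<Rightarrow> 'g \<Rightarrow> real) \<Rightarrow> bool" where
  "tensor2 T \<longleftrightarrow>
     (\<forall>X\<in>vector_fields A. \<forall>Y\<in>vector_fields A. smooth_fun A (T X Y)) \<and>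
     (\<forall>X\<in>vector_fields A. \<forall>X'\<in>vector_fields A. \<forall>Y\<in>vector_fields A.
        T (X + X') Y = (\<lambda>p. T X Y p + T X' Y p) \<and> T Y (X + X') = (\<lambda>p. T Y X p + T Y X' p)) \<and>
     (\<forall>h. \<forall>X\<in>vector_fields A. \<forall>Y\<in>vector_fields A. smooth_fun A h \<longrightarrow>
        T (fscale h X) Y = (\<lambda>p. h p * T X Y p) \<and> T X (fscale h Y) = (\<lambda>p. h p * T X Y p))"

lemma tensor2D:
  assumes "tensor2 T"
  shows "X \<in> vector_fields A \<Longrightarrow> Y \<in> vector_fields A \<Longrightarrow> smooth_fun A (T X Y)"
    and "X \<in> vector_fields A \<Longrightarrow> X' \<in> vector_fields A \<Longrightarrow> Y \<in> vector_fields A \<Longrightarrow>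
      T (X + X') Y = (\<lambda>p. T X Y p + T X' Y p)"
    and "X \<in> vector_fields A \<Longrightarrow> X' \<in> vector_fields A \<Longrightarrow> Y \<in> vector_fields A \<Longrightarrow>
      T Y (X + X') = (\<lambda>p. T Y X p + T Y X' p)"
    and "X \<in> vector_fields A \<Longrightarrow> Y \<in> vector_fields A \<Longrightarrow> smooth_fun A h \<Longrightarrow>
      T (fscale h X) Y = (\<lambda>p. h p * T X Y p)"
    and "X \<in> vector_fields A \<Longrightarrow> Y \<in> vector_fields A \<Longrightarrow> smooth_fun A h \<Longrightarrow>
      T X (fscale h Y) = (\<lambda>p. h p * T X Y p)"
    and "X \<in> vector_fields A \<Longrightarrow> Y \<in> vector_fields A \<Longrightarrow> T (c \<odot> X) Y = (\<lambda>p. c * T X Y p)"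
    and "X \<in> vector_fields A \<Longrightarrow> Y \<in> vector_fields A \<Longrightarrow> T X (c \<odot> Y) = (\<lambda>p. c * T X Y p)"
    and "X \<in> vector_fields A \<Longrightarrow> Y \<in> vector_fields A \<Longrightarrow> T (- X) Y = (\<lambda>p. - T X Y p)"
    and "X \<in> vector_fields A \<Longrightarrow> Y \<in> vector_fields A \<Longrightarrow> T X (- Y) = (\<lambda>p. - T X Y p)"
    and "X \<in> vector_fields A \<Longrightarrow> X' \<in> vector_fields A \<Longrightarrow> Y \<in> vector_fields A \<Longrightarrow>
      T (X - X') Y = (\<lambda>p. T X Y p - T X' Y p)"
    and "X \<in> vector_fields A \<Longrightarrow> X' \<in> vector_fields A \<Longrightarrow> Y \<in> vector_fields A \<Longrightarrow>
      T Y (X - X') = (\<lambda>p. T Y X p - T Y X' p)"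
proof -
  note T = assms[unfolded tensor2_def]
  show 1: "X \<in> vector_fields A \<Longrightarrow> Y \<in> vector_fields A \<Longrightarrow> smooth_fun A (T X Y)" for X Y
    using T by blast
  show 2: "X \<in> vector_fields A \<Longrightarrow> X' \<in> vector_fields A \<Longrightarrow> Y \<in> vector_fields A \<Longrightarrow>
      T (X + X') Y = (\<lambda>p. T X Y p + T X' Y p)" for X X' Y
    using T by blast
  show 3: "X \<in> vector_fields A \<Longrightarrow> X' \<in> vector_fields A \<Longrightarrow> Y \<in> vector_fields A \<Longrightarrow>
      T Y (X + X') = (\<lambda>p. T Y X p + T Y X' p)" for X X' Y
    using T by blast
  show 4: "X \<in> vector_fields A \<Longrightarrow> Y \<in> vector_fields A \<Longrightarrow> smooth_fun A h \<Longrightarrow>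
      T (fscale h X) Y = (\<lambda>p. h p * T X Y p)" for X Y h
    using T by blast
  show 5: "X \<in> vector_fields A \<Longrightarrow> Y \<in> vector_fields A \<Longrightarrow> smooth_fun A h \<Longrightarrow>
      T X (fscale h Y) = (\<lambda>p. h p * T X Y p)" for X Y h
    using T by blast
  show 6: "X \<in> vector_fields A \<Longrightarrow> Y \<in> vector_fields A \<Longrightarrow> T (c \<odot> X) Y = (\<lambda>p. c * T X Y p)" for c X Y
    by (simp add: vscale_def 4)
  show 7: "X \<in> vector_fields A \<Longrightarrow> Y \<in> vector_fields A \<Longrightarrow> T X (c \<odot> Y) = (\<lambda>p. c * T X Y p)" for c X Y
    by (simp add: vscale_def 5)
  show 8: "X \<in> vector_fields A \<Longrightarrow> Y \<in> vector_fields A \<Longrightarrow> T (- X) Y = (\<lambda>p. - T X Y p)" for X Y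
    using 6[of X Y "-1"] by simp
  show 9: "X \<in> vector_fields A \<Longrightarrow> Y \<in> vector_fields A \<Longrightarrow> T X (- Y) = (\<lambda>p. - T X Y p)" for X Y
    using 7[of X Y "-1"] by simp
  show "X \<in> vector_fields A \<Longrightarrow> X' \<in> vector_fields A \<Longrightarrow> Y \<in> vector_fields A \<Longrightarrow>
      T (X - X') Y = (\<lambda>p. T X Y p - T X' Y p)"
    using 2[of X "- X'" Y] by (simp add: 8)
  show "X \<in> vector_fields A \<Longrightarrow> X' \<in> vector_fields A \<Longrightarrow> Y \<in> vector_fields A \<Longrightarrow>
      T Y (X - X') = (\<lambda>p. T Y X p - T Y X' p)"
    using 3[of X "- X'" Y] by (simp add: 9)
qed

lemma tensor2_symmetrization: "tensor2 T \<Longrightarrow> tensor2 (symmetrization T)"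
  unfolding tensor2_def symmetrization_def
  using smooth_fun_mult[of "\<lambda>_. 1/2"] smooth_fun_add
  by (simp add: add_divide_distrib algebra_simps)

end

lemma fscale_uminus_one: "- X = fscale (\<lambda>_. - 1) X"
  by (simp add: fun_eq_iff fscale_def tscale_def)

text \<open>The bracket is only ever formed in the presence of a torsion-free connection, which makes this
  assumption immediate and avoids the symmetry of second derivatives.\<close>

locale bracket_closed_manifold = smooth_manifold A
  for A :: "('g::topological_space, 'm::euclidean_space) atlas" +
  assumes lie_bracket_closed [simp]:
    "X \<in> vector_fields A \<Longrightarrow> Y \<in> vector_fields A \<Longrightarrow> lie_bracket X Y \<in> vector_fields A"
begin

text \<open>When \<open>X\<close> is scaled by \<open>h\<close>, the first term contributes the
  extra \<open>\<xi>(h) T(X, Y)\<close>; the bracket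
  \<open>[\<xi>, h X] = h [\<xi>, X] + \<xi>(h) X\<close> contributes the same with the opposite
  sign. The other slot is alike.\<close>

lemma tensor2_lie_derivative:
  assumes T: "tensor2 T" and [simp]: "\<xi> \<in> vector_fields A"
  shows "tensor2 (lie_derivative \<xi> T)"
  unfolding tensor2_def
proof (intro conjI ballI allI impI)
  fix X Y assume [simp]: "X \<in> vector_fields A" "Y \<in> vector_fields A"
  show "smooth_fun A (lie_derivative \<xi> T X Y)"
    by (simp add: lie_derivative_def tensor2D(1)[OF T] smooth_fun_field[of \<xi>])
next
  fix X X' Y assume [simp]: "X \<in> vector_fields A" "X' \<in> vector_fields A" "Y \<in> vector_fields A"
  show "lie_derivative \<xi> T (X + X') Y = (\<lambda>p. lie_derivative \<xi> T X Y p + lie_derivative \<xi> T X' Y p)"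
    by (simp add: lie_derivative_def fun_eq_iff tensor2D[OF T] lie_bracket_add_right field_add[of \<xi>])
  show "lie_derivative \<xi> T Y (X + X') = (\<lambda>p. lie_derivative \<xi> T Y X p + lie_derivative \<xi> T Y X' p)"
    by (simp add: lie_derivative_def fun_eq_iff tensor2D[OF T] lie_bracket_add_right field_add[of \<xi>])
next
  fix h X Y assume [simp]: "X \<in> vector_fields A" "Y \<in> vector_fields A" "smooth_fun A h"
  show "lie_derivative \<xi> T (fscale h X) Y = (\<lambda>p. h p * lie_derivative \<xi> T X Y p)"
    by (simp add: lie_derivative_def fun_eq_iff tensor2D[OF T] lie_bracket_fscale_right field_mult[of \<xi>]
        smooth_fun_field[of \<xi>]
        algebra_simps)
  show "lie_derivative \<xi> T X (fscale h Y) = (\<lambda>p. h p * lie_derivative \<xi> T X Y p)"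
    by (simp add: lie_derivative_def fun_eq_iff tensor2D[OF T] lie_bracket_fscale_right field_mult[of \<xi>]
        smooth_fun_field[of \<xi>]
        algebra_simps)
qed

end

section \<open>Affine connections and the tensoriality of curvature\<close>

locale connection_manifold = bracket_closed_manifold A
  for A :: "('g::topological_space, 'm::euclidean_space) atlas" +
  fixes D :: "'g vfield \<Rightarrow> 'g vfield \<Rightarrow> 'g vfield"
  assumes connection: "affine_connection A D"
begin

lemma D_closed [simp]: "X \<in> vector_fields A \<Longrightarrow> Y \<in> vector_fields A \<Longrightarrow> D X Y \<in> vector_fields A"
  using connection unfolding affine_connection_def by blast

lemma D_add_left: "X \<in> vector_fields A \<Longrightarrow> X' \<in> vector_fields A \<Longrightarrow> Y \<in> vector_fields A \<Longrightarrow>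
    D (X + X') Y = D X Y + D X' Y"
  using connection unfolding affine_connection_def by blast

lemma D_add_right: "X \<in> vector_fields A \<Longrightarrow> X' \<in> vector_fields A \<Longrightarrow> Y \<in> vector_fields A \<Longrightarrow>
    D Y (X + X') = D Y X + D Y X'"
  using connection unfolding affine_connection_def by blast

lemma D_fscale_left: "X \<in> vector_fields A \<Longrightarrow> Y \<in> vector_fields A \<Longrightarrow> smooth_fun A h \<Longrightarrow>
    D (fscale h X) Y = fscale h (D X Y)"
  using connection unfolding affine_connection_def by blast

lemma D_fscale_right: "X \<in> vector_fields A \<Longrightarrow> Y \<in> vector_fields A \<Longrightarrow> smooth_fun A h \<Longrightarrow>
    D X (fscale h Y) = fscale h (D X Y) + fscale (\<lambda>p. X p h) Y"
  using connection unfolding affine_connection_def by blast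

lemma D_minus_left: "X \<in> vector_fields A \<Longrightarrow> Y \<in> vector_fields A \<Longrightarrow> D (- X) Y = - D X Y"
  using D_fscale_left[of X Y "\<lambda>_. -1"] by (simp flip: fscale_uminus_one)

lemma D_minus_right: "X \<in> vector_fields A \<Longrightarrow> Y \<in> vector_fields A \<Longrightarrow> D X (- Y) = - D X Y"
  using D_fscale_right[of X Y "\<lambda>_. -1"]
  by (simp flip: fscale_uminus_one) (simp add: fun_eq_iff fscale_def tscale_def)

lemma D_diff_left: "X \<in> vector_fields A \<Longrightarrow> X' \<in> vector_fields A \<Longrightarrow> Y \<in> vector_fields A \<Longrightarrow>
    D (X - X') Y = D X Y - D X' Y"
  using D_add_left[of X "- X'" Y] by (simp add: D_minus_left)

lemma D_diff_right: "X \<in> vector_fields A \<Longrightarrow> X' \<in> vector_fields A \<Longrightarrow> Y \<in> vector_fields A \<Longrightarrow>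
    D Y (X - X') = D Y X - D Y X'"
  using D_add_right[of X "- X'" Y] by (simp add: D_minus_right)

lemma curvature_closed [simp]:
  "X \<in> vector_fields A \<Longrightarrow> Y \<in> vector_fields A \<Longrightarrow> Z \<in> vector_fields A \<Longrightarrow>
    curvature D X Y Z \<in> vector_fields A"
  by (simp add: curvature_def)

lemma curvature_add_1:
  assumes "X \<in> vector_fields A" "X' \<in> vector_fields A" "Y \<in> vector_fields A" "Z \<in> vector_fields A"
  shows "curvature D (X + X') Y Z = curvature D X Y Z + curvature D X' Y Z"
  using assms by (simp add: curvature_def D_add_left D_add_right lie_bracket_add_left)

lemma curvature_add_3:
  assumes "X \<in> vector_fields A" "Z' \<in> vector_fields A" "Y \<in> vector_fields A" "Z \<in> vector_fields A"
  shows "curvature D X Y (Z + Z') = curvature D X Y Z + curvature D X Y Z'"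
  using assms by (simp add: curvature_def D_add_left D_add_right)

text \<open>The derivative of \<open>h\<close> in \<open>D Y (D (h X) Z)\<close> cancels against the
  term \<open>Y(h) X\<close> in the bracket \<open>[h X, Y]\<close>.\<close>

lemma curvature_fscale_1:
  assumes "X \<in> vector_fields A" "Y \<in> vector_fields A" "Z \<in> vector_fields A" "smooth_fun A h"
  shows "curvature D (fscale h X) Y Z = fscale h (curvature D X Y Z)"
  using assms
  by (simp add: curvature_def D_fscale_left D_fscale_right D_diff_left lie_bracket_fscale_left
      smooth_fun_field[of Y])
     (simp add: fun_eq_iff fscale_def tscale_def algebra_simps)

text \<open>The mixed terms with one derivative of \<open>h\<close> are symmetric in
  \<open>X\<close> and \<open>Y\<close> and cancel. The second derivatives combine to
  \<open>X(Y(h)) - Y(X(h)) - [X, Y](h)\<close>, which is 0 by definition of the bracket.\<close>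

lemma curvature_fscale_3:
  assumes "X \<in> vector_fields A" "Y \<in> vector_fields A" "Z \<in> vector_fields A" "smooth_fun A h"
  shows "curvature D X Y (fscale h Z) = fscale h (curvature D X Y Z)"
  using assms
  by (simp add: curvature_def D_fscale_right D_add_right smooth_fun_field[of X]
      smooth_fun_field[of Y])
     (simp add: fun_eq_iff fscale_def tscale_def lie_bracket_def algebra_simps)

end

section \<open>Lorentzian metrics and the Ricci tensor\<close>

locale lorentzian_manifold = smooth_manifold A
  for A :: "('g::topological_space, 'm::euclidean_space) atlas" +
  fixes g :: "'g \<Rightarrow> 'g tvec \<Rightarrow> 'g tvec \<Rightarrow> real"
  assumes metric: "lorentzian_metric A g"
begin

lemma metric_sym: "u \<in> tangent_space A p \<Longrightarrow> v \<in> tangent_space A p \<Longrightarrow> g p u v = g p v u"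
  by (rule metric[unfolded lorentzian_metric_def, THEN conjunct1, rule_format])

lemma metric_add_left: "u \<in> tangent_space A p \<Longrightarrow> v \<in> tangent_space A p \<Longrightarrow> w \<in> tangent_space A p \<Longrightarrow>
    g p (u + v) w = g p u w + g p v w"
  by (rule metric[unfolded lorentzian_metric_def, THEN conjunct2, THEN conjunct1, rule_format])

lemma metric_scale_left: "u \<in> tangent_space A p \<Longrightarrow> v \<in> tangent_space A p \<Longrightarrow>
    g p (tscale c u) v = c * g p u v"
  by (rule metric[unfolded lorentzian_metric_def, THEN conjunct2, THEN conjunct2, THEN conjunct1, rule_format])

lemma on_fields_sym: "X \<in> vector_fields A \<Longrightarrow> Y \<in> vector_fields A \<Longrightarrow> on_fields g X Y = on_fields g Y X"
  unfolding on_fields_def by (intro ext metric_sym field_tangent)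

lemma tensor2_metric: "tensor2 (on_fields g)"
  unfolding tensor2_def
proof (intro conjI ballI allI impI)
  fix X Y assume XY: "X \<in> vector_fields A" "Y \<in> vector_fields A"
  then show "smooth_fun A (on_fields g X Y)"
    by (rule metric[unfolded lorentzian_metric_def, THEN conjunct2, THEN conjunct2, THEN conjunct2,
          THEN conjunct2, rule_format])
next
  fix X X' Y assume *: "X \<in> vector_fields A" "X' \<in> vector_fields A" "Y \<in> vector_fields A"
  then show 1: "on_fields g (X + X') Y = (\<lambda>p. on_fields g X Y p + on_fields g X' Y p)"
    by (simp add: on_fields_def metric_add_left)
  show "on_fields g Y (X + X') = (\<lambda>p. on_fields g Y X p + on_fields g Y X' p)"
    using 1 * by (simp add: on_fields_sym[of Y])
next
  fix h X Y assume *: "X \<in> vector_fields A" "Y \<in> vector_fields A" "smooth_fun A h"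
  then show "on_fields g (fscale h X) Y = (\<lambda>p. h p * on_fields g X Y p)"
    by (simp add: on_fields_def fscale_def metric_scale_left)
  have "on_fields g (fscale h Y) X = (\<lambda>p. h p * on_fields g Y X p)"
    using * by (simp add: on_fields_def fscale_def metric_scale_left)
  then show "on_fields g X (fscale h Y) = (\<lambda>p. h p * on_fields g X Y p)"
    using * by (simp add: on_fields_sym[of X])
qed

lemmas on_fields_simps = tensor2D[OF tensor2_metric]

lemma smooth_fun_on_fields [simp]:
  "X \<in> vector_fields A \<Longrightarrow> Y \<in> vector_fields A \<Longrightarrow> smooth_fun A (on_fields g X Y)"
  by (rule on_fields_simps(1))

text \<open>The metric acts pointwise, so arbitrary coefficient functions \<open>h\<close> can be
  pulled out. This applies to \<open>Omega X Y\<close> without a smoothness side condition.\<close>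

lemma on_fields_fscale [simp]:
  assumes "X \<in> vector_fields A" "Y \<in> vector_fields A"
  shows "on_fields g (fscale h X) Y p = h p * on_fields g X Y p"
  using assms by (simp add: on_fields_def fscale_def metric_scale_left)

lemma on_fields_zero_left [simp]: "X \<in> vector_fields A \<Longrightarrow> on_fields g 0 X = (\<lambda>_. 0)"
  using on_fields_simps(6)[of X X 0] by simp

text \<open>The two arguments of the Ricci tensor sit in the first and third slot of the curvature,
  where it is linear over the smooth functions; pairing with a fixed frame field preserves
  this.\<close>

lemma tensor2_ricci:
  assumes "connection_manifold A D"
    and [simp]: "e1 \<in> vector_fields A" "e2 \<in> vector_fields A" "e3 \<in> vector_fields A"
  shows "tensor2 (ricci g D e1 e2 e3)"
proof -
  interpret connection_manifold A D by fact
  show ?thesis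
    unfolding tensor2_def ricci_def
    by (simp add: on_fields_simps curvature_add_1 curvature_add_3 curvature_fscale_1
        curvature_fscale_3 fun_eq_iff algebra_simps)
qed

end

section \<open>The Levi-Civita connection\<close>

locale levi_civita_manifold = lorentzian_manifold A g
  for A :: "('g::topological_space, 'm::euclidean_space) atlas"
    and g :: "'g \<Rightarrow> 'g tvec \<Rightarrow> 'g tvec \<Rightarrow> real" +
  fixes nabla :: "'g vfield \<Rightarrow> 'g vfield \<Rightarrow> 'g vfield"
  assumes levi_civita: "levi_civita A g nabla"
begin

lemma torsion_free:
  "X \<in> vector_fields A \<Longrightarrow> Y \<in> vector_fields A \<Longrightarrow> nabla X Y - nabla Y X = lie_bracket X Y"
  by (rule levi_civita[unfolded levi_civita_def, THEN conjunct2, THEN conjunct1, rule_format])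

lemma metric_compatible:
  "X \<in> vector_fields A \<Longrightarrow> Y \<in> vector_fields A \<Longrightarrow> Z \<in> vector_fields A \<Longrightarrow>
    X p (on_fields g Y Z) = on_fields g (nabla X Y) Z p + on_fields g Y (nabla X Z) p"
  by (rule levi_civita[unfolded levi_civita_def, THEN conjunct2, THEN conjunct2, rule_format])

sublocale connection_manifold A nabla
proof
  show conn: "affine_connection A nabla"
    by (rule levi_civita[unfolded levi_civita_def, THEN conjunct1])
  fix X Y assume XY: "X \<in> vector_fields A" "Y \<in> vector_fields A"
  then have "nabla X Y \<in> vector_fields A" "nabla Y X \<in> vector_fields A"
    using conn[unfolded affine_connection_def, THEN conjunct1] by auto
  then show "lie_bracket X Y \<in> vector_fields A"
    unfolding torsion_free[OF XY, symmetric] by simp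
qed

text \<open>The Koszul formula for fields with constant mutual products, whose derivative terms
  vanish. Metric compatibility gives one equation for each of \<open>X\<close>, \<open>Y\<close>,
  \<open>Z\<close> as direction of differentiation; expanding the brackets by torsion-freeness and
  combining these with signs plus, minus, plus leaves twice the wanted product.\<close>

lemma koszul_constant:
  assumes [simp]: "X \<in> vector_fields A" "Y \<in> vector_fields A" "Z \<in> vector_fields A"
    and XY: "on_fields g X Y = (\<lambda>_. a)" and YZ: "on_fields g Y Z = (\<lambda>_. b)"
    and ZX: "on_fields g Z X = (\<lambda>_. c)"
  shows "2 * on_fields g (nabla X Y) Z p =
    on_fields g (lie_bracket X Y) Z p - on_fields g (lie_bracket Y Z) X p + on_fields g (lie_bracket Z X) Y p"
proof -
  have "on_fields g (nabla X Y) Z p + on_fields g (nabla X Z) Y p = 0"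
    using metric_compatible[of X Y Z p] by (simp add: YZ on_fields_sym[of Y "nabla X Z"])
  moreover have "on_fields g (nabla Y Z) X p + on_fields g (nabla Y X) Z p = 0"
    using metric_compatible[of Y Z X p] by (simp add: ZX on_fields_sym[of Z "nabla Y X"])
  moreover have "on_fields g (nabla Z X) Y p + on_fields g (nabla Z Y) X p = 0"
    using metric_compatible[of Z X Y p] by (simp add: XY on_fields_sym[of X "nabla Z Y"])
  ultimately show ?thesis
    by (simp add: torsion_free[symmetric] on_fields_simps)
qed

end

section \<open>The canonical connection of a product structure\<close>

locale product_levi_civita_manifold = levi_civita_manifold A g nabla
  for A :: "('g::topological_space, 'm::euclidean_space) atlas"
    and g :: "'g \<Rightarrow> 'g tvec \<Rightarrow> 'g tvec \<Rightarrow> real"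
    and nabla :: "'g vfield \<Rightarrow> 'g vfield \<Rightarrow> 'g vfield" +
  fixes J :: "'g \<Rightarrow> 'g tvec \<Rightarrow> 'g tvec"
  assumes product_structure: "product_structure A J"
begin

abbreviation nabla0 where "nabla0 \<equiv> canonical_connection nabla J"

lemma J_closed [simp]: "X \<in> vector_fields A \<Longrightarrow> apply_field J X \<in> vector_fields A"
  by (rule product_structure[unfolded product_structure_def, THEN conjunct2, THEN conjunct2,
        THEN conjunct2, rule_format])

lemma J_J [simp]: "X \<in> vector_fields A \<Longrightarrow> apply_field J (apply_field J X) = X"
  unfolding apply_field_def
  by (intro ext fun_cong[OF product_structure[unfolded product_structure_def, THEN conjunct1,
        rule_format, THEN conjunct2]] field_tangent)

lemma J_add: "X \<in> vector_fields A \<Longrightarrow> Y \<in> vector_fields A \<Longrightarrow>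
    apply_field J (X + Y) = apply_field J X + apply_field J Y"
  unfolding apply_field_def plus_fun_def[of X] plus_fun_def[of "\<lambda>p. J p (X p)"]
  by (intro ext fun_cong[OF product_structure[unfolded product_structure_def, THEN conjunct2,
        THEN conjunct1, rule_format]] field_tangent)

lemma J_fscale: "X \<in> vector_fields A \<Longrightarrow> apply_field J (fscale h X) = fscale h (apply_field J X)"
  unfolding apply_field_def fscale_def
  by (intro ext fun_cong[OF product_structure[unfolded product_structure_def, THEN conjunct2,
        THEN conjunct2, THEN conjunct1, rule_format]] field_tangent)

lemma J_minus: "X \<in> vector_fields A \<Longrightarrow> apply_field J (- X) = - apply_field J X"
  using J_fscale[of X "\<lambda>_. -1"] by (simp flip: fscale_uminus_one)

text \<open>As \<open>J\<close> squares to the identity, \<open>deriv_endo nabla J X (J Y)\<close>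
  is \<open>nabla X Y - J (nabla X (J Y))\<close>. Removing half of it from \<open>nabla X Y\<close>
  leaves the average of \<open>nabla\<close> and its conjugate by \<open>J\<close>.\<close>

lemma canonical_connection_eq:
  assumes "X \<in> vector_fields A" "Y \<in> vector_fields A"
  shows "nabla0 X Y = (1/2) \<odot> (nabla X Y + apply_field J (nabla X (apply_field J Y)))"
  using assms unfolding canonical_connection_def deriv_endo_def
  by simp (simp add: fun_eq_iff vscale_def fscale_def tscale_def algebra_simps)

text \<open>An average of two connections is a connection: in the Leibniz rule for the conjugate of
  \<open>nabla\<close> the extra term is \<open>X(h) J (J Y) = X(h) Y\<close>.\<close>

sublocale canonical: connection_manifold A nabla0
proof
  note [simp] = canonical_connection_eq D_add_left D_add_right D_fscale_left D_fscale_right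
    J_add J_fscale smooth_fun_field
  show "affine_connection A nabla0"
    unfolding affine_connection_def
  proof (intro conjI ballI allI impI)
    fix X Y assume XY: "X \<in> vector_fields A" "Y \<in> vector_fields A"
    then show "nabla0 X Y \<in> vector_fields A"
      by simp
  next
    fix X X' Y assume *: "X \<in> vector_fields A" "X' \<in> vector_fields A" "Y \<in> vector_fields A"
    then show "nabla0 (X + X') Y = nabla0 X Y + nabla0 X' Y"
      by (simp add: algebra_simps vfield.scale_right_distrib)
    show "nabla0 Y (X + X') = nabla0 Y X + nabla0 Y X'"
      using * by (simp add: algebra_simps vfield.scale_right_distrib)
  next
    fix h X Y assume *: "X \<in> vector_fields A" "Y \<in> vector_fields A" "smooth_fun A h"
    then show "nabla0 (fscale h X) Y = fscale h (nabla0 X Y)"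
      by simp (simp add: fun_eq_iff vscale_def fscale_def tscale_def algebra_simps)
    show "nabla0 X (fscale h Y) = fscale h (nabla0 X Y) + fscale (\<lambda>p. X p h) Y"
      using * by simp (simp add: fun_eq_iff vscale_def fscale_def tscale_def field_simps)
  qed
qed

end

section \<open>Pseudo-orthonormal frames\<close>

locale lorentzian_frame = lorentzian_manifold A g
  for A :: "('g::topological_space, real ^ 3) atlas"
    and g :: "'g \<Rightarrow> 'g tvec \<Rightarrow> 'g tvec \<Rightarrow> real" +
  fixes e1 e2 e3 :: "'g vfield"
  assumes frame_closed [simp]:
      "e1 \<in> vector_fields A" "e2 \<in> vector_fields A" "e3 \<in> vector_fields A"
    and pseudo_orthonormal: "pseudo_orthonormal g e1 e2 e3"
begin

lemma frame_metric [simp]: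
  "on_fields g e1 e1 = (\<lambda>_. 1)" "on_fields g e2 e2 = (\<lambda>_. 1)" "on_fields g e3 e3 = (\<lambda>_. - 1)"
  "on_fields g e1 e2 = (\<lambda>_. 0)" "on_fields g e1 e3 = (\<lambda>_. 0)" "on_fields g e2 e3 = (\<lambda>_. 0)"
  "on_fields g e2 e1 = (\<lambda>_. 0)" "on_fields g e3 e1 = (\<lambda>_. 0)" "on_fields g e3 e2 = (\<lambda>_. 0)"
  using pseudo_orthonormal on_fields_sym[of e2 e1] on_fields_sym[of e3 e1] on_fields_sym[of e3 e2]
  by (simp_all add: pseudo_orthonormal_def fun_eq_iff)

text \<open>Pairing with the frame reads off coefficients, up to a sign for the timelike
  \<open>e3\<close>. This yields both linear independence and the expansion of fields.\<close>

lemma frame_metric_combination: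
  shows "g p (tscale a (e1 p) + tscale b (e2 p) + tscale c (e3 p)) (e1 p) = a"
    and "g p (tscale a (e1 p) + tscale b (e2 p) + tscale c (e3 p)) (e2 p) = b"
    and "g p (tscale a (e1 p) + tscale b (e2 p) + tscale c (e3 p)) (e3 p) = - c"
  using pseudo_orthonormal metric_sym[of "e1 p" p "e2 p"] metric_sym[of "e1 p" p "e3 p"]
    metric_sym[of "e2 p" p "e3 p"]
  by (simp_all add: pseudo_orthonormal_def on_fields_def metric_add_left metric_scale_left)

lemma frame_combination_eq_iff:
  "a \<odot> e1 + b \<odot> e2 + c \<odot> e3 = a' \<odot> e1 + b' \<odot> e2 + c' \<odot> e3 \<longleftrightarrow> a = a' \<and> b = b' \<and> c = c'"
proof
  assume *: "a \<odot> e1 + b \<odot> e2 + c \<odot> e3 = a' \<odot> e1 + b' \<odot> e2 + c' \<odot> e3"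
  have "on_fields g (a \<odot> e1 + b \<odot> e2 + c \<odot> e3) e p = on_fields g (a' \<odot> e1 + b' \<odot> e2 + c' \<odot> e3) e p" for e p
    by (simp only: *)
  from this[of e1] this[of e2] this[of e3] show "a = a' \<and> b = b' \<and> c = c'"
    by (simp add: on_fields_simps)
qed simp

text \<open>A dimension count in a chart: sending coefficients to the coordinate vector of the frame
  combination is a linear endomorphism \<open>L\<close> of \<open>real ^ 3\<close>. The metric
  recovers the coefficients, so \<open>L\<close> is injective and therefore surjective.\<close>

lemma frame_spans_tangent_space:
  assumes "u \<in> tangent_space A p"
  obtains a b c where "u = tscale a (e1 p) + tscale b (e2 p) + tscale c (e3 p)"
proof -
  obtain U \<phi> where U: "(U, \<phi>) \<in> A" "p \<in> U" by (rule chart_at)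
  obtain w where w: "u = chart_tvec U \<phi> p w" by (rule tangent_chart_tvec[OF assms U])
  obtain w1 where w1: "e1 p = chart_tvec U \<phi> p w1"
    by (rule tangent_chart_tvec[OF field_tangent[OF frame_closed(1)] U])
  obtain w2 where w2: "e2 p = chart_tvec U \<phi> p w2"
    by (rule tangent_chart_tvec[OF field_tangent[OF frame_closed(2)] U])
  obtain w3 where w3: "e3 p = chart_tvec U \<phi> p w3"
    by (rule tangent_chart_tvec[OF field_tangent[OF frame_closed(3)] U])
  define L :: "real ^ 3 \<Rightarrow> real ^ 3" where "L x = x$1 *\<^sub>R w1 + x$2 *\<^sub>R w2 + x$3 *\<^sub>R w3" for x
  have L: "chart_tvec U \<phi> p (L x) = tscale (x$1) (e1 p) + tscale (x$2) (e2 p) + tscale (x$3) (e3 p)" for x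
    by (simp add: L_def chart_tvec_add[OF U] chart_tvec_scale[OF U] w1 w2 w3)
  have "linear L"
    by (intro linearI) (simp_all add: L_def algebra_simps)
  moreover have "inj L"
  proof (rule injI)
    fix x y assume "L x = L y"
    then have "tscale (x$1) (e1 p) + tscale (x$2) (e2 p) + tscale (x$3) (e3 p) =
      tscale (y$1) (e1 p) + tscale (y$2) (e2 p) + tscale (y$3) (e3 p)"
      by (metis L)
    then have "x$1 = y$1" "x$2 = y$2" "x$3 = y$3"
      using frame_metric_combination[of p "x$1" "x$2" "x$3"]
        frame_metric_combination[of p "y$1" "y$2" "y$3"] by simp_all
    then show "x = y" by (simp add: vec_eq_iff forall_3)
  qed
  ultimately obtain x where "w = L x"
    using linear_injective_imp_surjective by (metis surjD)
  then show ?thesis using that w L by blast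
qed

lemma field_frame_expansion:
  assumes "X \<in> vector_fields A"
  shows "X = fscale (on_fields g X e1) e1 + fscale (on_fields g X e2) e2
    + fscale (\<lambda>p. - on_fields g X e3 p) e3"
proof
  fix p
  obtain a b c where abc: "X p = tscale a (e1 p) + tscale b (e2 p) + tscale c (e3 p)"
    by (rule frame_spans_tangent_space[OF field_tangent[OF assms]])
  then have "on_fields g X e1 p = a" "on_fields g X e2 p = b" "on_fields g X e3 p = - c"
    by (simp_all add: on_fields_def frame_metric_combination)
  then show "X p = (fscale (on_fields g X e1) e1 + fscale (on_fields g X e2) e2
    + fscale (\<lambda>p. - on_fields g X e3 p) e3) p"
    using abc by (simp add: fscale_def)
qed

text \<open>Both arguments are expanded in the frame with function coefficients: first the second
  one, with a frame field in the first slot, then the first one.\<close>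

lemma tensor2_zero_iff:
  assumes T: "tensor2 T"
  shows "(\<forall>X\<in>vector_fields A. \<forall>Y\<in>vector_fields A. \<forall>p. T X Y p = 0) \<longleftrightarrow>
    (\<forall>X\<in>{e1, e2, e3}. \<forall>Y\<in>{e1, e2, e3}. T X Y = (\<lambda>_. 0))"
proof
  assume *: "\<forall>X\<in>{e1, e2, e3}. \<forall>Y\<in>{e1, e2, e3}. T X Y = (\<lambda>_. 0)"
  have 1: "T X Y p = 0" if "X \<in> {e1, e2, e3}" "Y \<in> vector_fields A" for X Y p
  proof -
    have X: "X \<in> vector_fields A" using that by auto
    have zero: "T X e1 p = 0" "T X e2 p = 0" "T X e3 p = 0" using * that by auto
    show ?thesis
      by (subst field_frame_expansion[OF that(2)])
         (use that X zero in \<open>simp add: tensor2D[OF T]\<close>)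
  qed
  show "\<forall>X\<in>vector_fields A. \<forall>Y\<in>vector_fields A. \<forall>p. T X Y p = 0"
  proof (intro ballI allI)
    fix X Y p assume XY: "X \<in> vector_fields A" "Y \<in> vector_fields A"
    show "T X Y p = 0"
      by (subst field_frame_expansion[OF XY(1)])
         (use 1 XY in \<open>simp add: tensor2D[OF T]\<close>)
  qed
qed (auto simp: fun_eq_iff)

end

section \<open>Connection form and curvature in a frame adapted to \<open>J\<close>\<close>

locale product_frame = product_levi_civita_manifold A g nabla J + lorentzian_frame A g e1 e2 e3
  for A :: "('g::topological_space, real ^ 3) atlas"
    and g :: "'g \<Rightarrow> 'g tvec \<Rightarrow> 'g tvec \<Rightarrow> real"
    and nabla :: "'g vfield \<Rightarrow> 'g vfield \<Rightarrow> 'g vfield"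
    and J :: "'g \<Rightarrow> 'g tvec \<Rightarrow> 'g tvec"
    and e1 e2 e3 :: "'g vfield" +
  assumes J_frame [simp]:
    "apply_field J e1 = e1" "apply_field J e2 = e2" "apply_field J e3 = - e3"
begin

definition omega :: "'g vfield \<Rightarrow> 'g \<Rightarrow> real" where
  "omega X = on_fields g (nabla X e1) e2"

definition Omega :: "'g vfield \<Rightarrow> 'g vfield \<Rightarrow> 'g \<Rightarrow> real" where
  "Omega X Y = (\<lambda>p. X p (omega Y) - Y p (omega X) - omega (lie_bracket X Y) p)"

lemma smooth_omega [simp]: "X \<in> vector_fields A \<Longrightarrow> smooth_fun A (omega X)"
  by (simp add: omega_def on_fields_simps)

lemma omega_simps:
  "X \<in> vector_fields A \<Longrightarrow> Y \<in> vector_fields A \<Longrightarrow> omega (X + Y) = (\<lambda>p. omega X p + omega Y p)"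
  "X \<in> vector_fields A \<Longrightarrow> Y \<in> vector_fields A \<Longrightarrow> omega (X - Y) = (\<lambda>p. omega X p - omega Y p)"
  "X \<in> vector_fields A \<Longrightarrow> omega (- X) = (\<lambda>p. - omega X p)"
  "X \<in> vector_fields A \<Longrightarrow> omega (c \<odot> X) = (\<lambda>p. c * omega X p)"
  by (simp_all add: omega_def D_add_left D_diff_left D_minus_left D_fscale_left vscale_def on_fields_simps)

lemma nabla_frame_norm:
  assumes [simp]: "X \<in> vector_fields A"
  shows "on_fields g (nabla X e1) e1 = (\<lambda>_. 0)" "on_fields g (nabla X e2) e2 = (\<lambda>_. 0)"
    "on_fields g (nabla X e3) e3 = (\<lambda>_. 0)"
  using metric_compatible[of X e1 e1] metric_compatible[of X e2 e2] metric_compatible[of X e3 e3]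
  by (simp_all add: fun_eq_iff on_fields_sym[of e1] on_fields_sym[of e2] on_fields_sym[of e3])

text \<open>The coefficient of \<open>e3\<close> in \<open>Z\<close> is \<open>- g(Z, e3)\<close>,
  and \<open>J\<close> changes its sign once more.\<close>

lemma J_frame_expansion:
  assumes [simp]: "Z \<in> vector_fields A"
  shows "apply_field J Z = fscale (on_fields g Z e1) e1 + fscale (on_fields g Z e2) e2
    + fscale (on_fields g Z e3) e3"
  by (subst (1) field_frame_expansion[OF assms])
     (simp add: J_add J_fscale, simp add: fun_eq_iff fscale_def tscale_def)

text \<open>Averaging with the \<open>J\<close>-conjugate projects \<open>nabla X e1\<close> and
  \<open>nabla X e2\<close> to the plane of \<open>e1\<close>, \<open>e2\<close>, and
  \<open>nabla X e3\<close> to the line of \<open>e3\<close>. Constancy of the norms removes the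
  component along the differentiated field itself.\<close>

lemma nabla0_frame:
  assumes [simp]: "X \<in> vector_fields A"
  shows "nabla0 X e1 = fscale (omega X) e2"
    and "nabla0 X e2 = fscale (\<lambda>p. - omega X p) e1"
    and "nabla0 X e3 = 0"
proof -
  \<comment> \<open>Skew symmetry, from differentiating \<open>g(e1, e2) = 0\<close> along
    \<open>X\<close>.\<close>
  have e12: "on_fields g (nabla X e2) e1 = (\<lambda>p. - omega X p)"
    using metric_compatible[of X e1 e2]
    by (simp add: omega_def fun_eq_iff on_fields_sym[of e1] eq_neg_iff_add_eq_0
        add.commute)
  note J1 = J_frame_expansion[of "nabla X e1"] J_frame_expansion[of "nabla X e2"]
    J_frame_expansion[of "nabla X e3"]
  note exp = field_frame_expansion[of "nabla X e1"] field_frame_expansion[of "nabla X e2"]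
    field_frame_expansion[of "nabla X e3"]
  show "nabla0 X e1 = fscale (omega X) e2"
    by (simp add: canonical_connection_eq J1, subst (1) exp(1), simp)
       (simp add: fun_eq_iff vscale_def fscale_def tscale_def nabla_frame_norm omega_def)
  show "nabla0 X e2 = fscale (\<lambda>p. - omega X p) e1"
    by (simp add: canonical_connection_eq J1, subst (1) exp(2), simp)
       (simp add: fun_eq_iff vscale_def fscale_def tscale_def nabla_frame_norm e12)
  show "nabla0 X e3 = 0"
    by (simp add: canonical_connection_eq D_minus_right J_minus J1, subst (1) exp(3), simp)
       (simp add: fun_eq_iff vscale_def fscale_def tscale_def nabla_frame_norm)
qed

lemma nabla0_zero [simp]: "X \<in> vector_fields A \<Longrightarrow> nabla0 X 0 = 0"
  using canonical.D_diff_right[of e1 e1 X] by simp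

text \<open>The connection acts by infinitesimal rotations of one plane, which commute. So the terms
  quadratic in \<open>omega\<close> cancel and the exterior derivative of \<open>omega\<close>
  remains.\<close>

lemma curvature_frame:
  assumes [simp]: "X \<in> vector_fields A" "Y \<in> vector_fields A"
  shows "curvature nabla0 X Y e1 = fscale (Omega X Y) e2"
    and "curvature nabla0 X Y e2 = fscale (\<lambda>p. - Omega X Y p) e1"
    and "curvature nabla0 X Y e3 = 0"
proof -
  have neg: "Z p (\<lambda>q. - omega W q) = - Z p (omega W)"
    if "Z \<in> vector_fields A" "W \<in> vector_fields A" for Z W p
    using field_cmult[OF that(1) smooth_omega[OF that(2)], of p "-1"] by simp
  show "curvature nabla0 X Y e1 = fscale (Omega X Y) e2"
    by (simp add: curvature_def nabla0_frame canonical.D_fscale_right)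
       (simp add: fun_eq_iff fscale_def tscale_def Omega_def algebra_simps)
  show "curvature nabla0 X Y e2 = fscale (\<lambda>p. - Omega X Y p) e1"
    by (simp add: curvature_def nabla0_frame canonical.D_fscale_right)
       (simp add: fun_eq_iff fscale_def tscale_def Omega_def neg algebra_simps)
  show "curvature nabla0 X Y e3 = 0"
    by (simp add: curvature_def nabla0_frame)
qed

lemma ricci_frame:
  assumes [simp]: "X \<in> vector_fields A"
  shows "ricci g nabla0 e1 e2 e3 X e1 = (\<lambda>p. - Omega X e2 p)"
    and "ricci g nabla0 e1 e2 e3 X e2 = Omega X e1"
    and "ricci g nabla0 e1 e2 e3 X e3 = (\<lambda>_. 0)"
  by (simp_all add: ricci_def curvature_frame fun_eq_iff)

end

section \<open>The Lie group $G_7$\<close>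

text \<open>The equations are the components of the Lie derivative, up to constant factors, for
  \<xi> with coefficients \<open>a\<close>, \<open>b\<close>, \<open>c\<close>. If \<alpha> is
  nonzero, then \<gamma> = 0 and \<open>k\<close> is the nonzero \<alpha> squared, so the first two
  equations force \<open>b = c\<close> and \<open>a = 0\<close>, and the fourth forces \<delta> or
  \<open>c\<close> to vanish.\<close>

lemma collineation_equations_iff:
  fixes a b c \<alpha> \<beta> \<gamma> \<delta> :: real
  assumes "\<alpha> + \<delta> \<noteq> 0" and "\<alpha> * \<gamma> = 0"
  defines "k \<equiv> \<alpha>\<^sup>2 + \<beta> * \<gamma> / 2"
  shows "(b - c) * (\<alpha> * k + \<beta> * \<gamma> * \<delta> / 4) = 0 \<and>
      (b - c) * \<beta> * k / 2 - a * (\<alpha> * k + \<beta> * \<gamma> * \<delta> / 4) - c * (\<gamma> * k + \<gamma> * \<delta>\<^sup>2 / 4) = 0 \<and>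
      - (b - c) * \<beta> * k / 2 + a * (\<alpha> * k + \<beta> * \<gamma> * \<delta> / 4) + b * (\<gamma> * k + \<gamma> * \<delta>\<^sup>2 / 4) = 0 \<and>
      (\<beta> * a + \<delta> * c) * k = 0 \<and>
      a * \<beta> * k + c * (\<delta> * k / 2 - \<gamma>\<^sup>2 * \<delta> / 4) + b * \<delta> * k / 2 = 0 \<and>
      a * \<beta> * k + b * (\<delta> * k - \<gamma>\<^sup>2 * \<delta> / 2) = 0 \<longleftrightarrow>
    \<alpha> = 0 \<and> \<gamma> = 0 \<or> \<alpha> = 0 \<and> \<beta> = 0 \<and> b = 0 \<and> c = 0 \<or>
    \<alpha> \<noteq> 0 \<and> \<delta> = 0 \<and> a = 0 \<and> b = c \<or> a = 0 \<and> b = 0 \<and> c = 0"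
    (is "?E \<longleftrightarrow> ?R")
proof (cases "\<alpha> = 0")
  case False
  then have "\<gamma> = 0" "k \<noteq> 0" using assms(2) by (auto simp: k_def)
  then show ?thesis using False by auto
next
  case True
  then have \<delta>: "\<delta> \<noteq> 0" using assms(1) by simp
  show ?thesis
  \<comment> \<open>With \<alpha> = 0, \<open>k\<close> is half of \<beta>\<gamma>, so this decides
    whether \<open>k\<close> vanishes.\<close>
  proof (cases "\<gamma> = 0 \<or> \<beta> = 0")
    case True
    then have "k = 0" using \<open>\<alpha> = 0\<close> by (auto simp: k_def)
    then show ?thesis using True \<open>\<alpha> = 0\<close> \<delta> by auto
  next
    case False
    then have k: "k \<noteq> 0" using \<open>\<alpha> = 0\<close> by (auto simp: k_def)
    show ?thesis
    proof
      assume E: ?E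
      have bc: "b = c" using E False \<delta> \<open>\<alpha> = 0\<close> by simp
      have a: "\<beta> * a = - \<delta> * c" using E k by (simp add: eq_neg_iff_add_eq_0)
      \<comment> \<open>Substituting \<beta>a = -\<delta>b into the last equation makes the terms
        with \<open>k\<close> cancel, so that it determines \<open>b\<close>.\<close>
      have "a * \<beta> * k + b * (\<delta> * k - \<gamma>\<^sup>2 * \<delta> / 2) = - b * (\<gamma>\<^sup>2 * \<delta> / 2)"
        using a bc by algebra
      then have "b = 0" using E False \<delta> by simp
      then show ?R using a bc False by simp
    qed (use \<open>\<alpha> = 0\<close> False in auto)
  qed
qed

section \<open>Connection form, Ricci tensor and collineations for the brackets of the Lie
  algebra\<close>

locale g7_frame = product_frame A g nabla J e1 e2 e3
  for A :: "('g::topological_space, real ^ 3) atlas"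
    and g :: "'g \<Rightarrow> 'g tvec \<Rightarrow> 'g tvec \<Rightarrow> real"
    and nabla :: "'g vfield \<Rightarrow> 'g vfield \<Rightarrow> 'g vfield"
    and J :: "'g \<Rightarrow> 'g tvec \<Rightarrow> 'g tvec"
    and e1 e2 e3 :: "'g vfield" +
  fixes \<alpha> \<beta> \<gamma> \<delta> :: real
  assumes bracket_frame:
      "lie_bracket e1 e2 = (- \<alpha>) \<odot> e1 - \<beta> \<odot> e2 - \<beta> \<odot> e3"
      "lie_bracket e1 e3 = \<alpha> \<odot> e1 + \<beta> \<odot> e2 + \<beta> \<odot> e3"
      "lie_bracket e2 e3 = \<gamma> \<odot> e1 + \<delta> \<odot> e2 + \<delta> \<odot> e3"
    and alpha_gamma: "\<alpha> * \<gamma> = 0"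
begin

abbreviation Ric where "Ric \<equiv> symmetrization (ricci g nabla0 e1 e2 e3)"

lemma bracket_frame_swap:
  "lie_bracket e2 e1 = - lie_bracket e1 e2"
  "lie_bracket e3 e1 = - lie_bracket e1 e3"
  "lie_bracket e3 e2 = - lie_bracket e2 e3"
  by (rule lie_bracket_swap)+

lemma omega_frame: "omega e1 = (\<lambda>_. \<alpha>)" "omega e2 = (\<lambda>_. \<beta>)" "omega e3 = (\<lambda>_. \<gamma> / 2 - \<beta>)"
proof -
  note [simp] = bracket_frame bracket_frame_swap on_fields_simps
  \<comment> \<open>The numbers passed to \<open>koszul_constant\<close> are the constants g(X, Y),
    g(Y, Z), g(Z, X) for the three chosen frame fields.\<close>
  have "2 * omega e1 p = 2 * \<alpha>" for p
    using koszul_constant[of e1 e1 e2 1 0 0 p] by (simp add: omega_def)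
  moreover have "2 * omega e2 p = 2 * \<beta>" for p
    using koszul_constant[of e2 e1 e2 0 0 1 p] by (simp add: omega_def)
  moreover have "2 * omega e3 p = \<gamma> - 2 * \<beta>" for p
    using koszul_constant[of e3 e1 e2 0 0 0 p] by (simp add: omega_def)
  ultimately show "omega e1 = (\<lambda>_. \<alpha>)" "omega e2 = (\<lambda>_. \<beta>)" "omega e3 = (\<lambda>_. \<gamma> / 2 - \<beta>)"
    by (auto simp: fun_eq_iff field_simps)
qed

text \<open>As \<open>omega\<close> is constant on the frame, \<open>Omega X Y\<close> is
  \<open>- omega (lie_bracket X Y)\<close> there; \<alpha>\<gamma> = 0 simplifies its value on
  \<open>e2\<close>, \<open>e3\<close>. The unsymmetrized Ricci tensor vanishes when its second
  argument is \<open>e3\<close>, so mixed components with \<open>e3\<close> are halves of a single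
  one.\<close>

lemma Ric_frame:
  defines "k \<equiv> \<alpha>\<^sup>2 + \<beta> * \<gamma> / 2"
  shows "Ric e1 e1 = (\<lambda>_. - k)" "Ric e2 e2 = (\<lambda>_. - k)" "Ric e3 e3 = (\<lambda>_. 0)"
    "Ric e1 e2 = (\<lambda>_. 0)" "Ric e2 e1 = (\<lambda>_. 0)"
    "Ric e1 e3 = (\<lambda>_. - \<gamma> * \<delta> / 4)" "Ric e3 e1 = (\<lambda>_. - \<gamma> * \<delta> / 4)"
    "Ric e2 e3 = (\<lambda>_. k / 2)" "Ric e3 e2 = (\<lambda>_. k / 2)"
proof -
  have "Omega e1 e2 = (\<lambda>_. k)" "Omega e1 e3 = (\<lambda>_. - k)" "Omega e2 e3 = (\<lambda>_. - \<gamma> * \<delta> / 2)"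
    "Omega e2 e1 = (\<lambda>_. - k)" "Omega e3 e1 = (\<lambda>_. k)" "Omega e3 e2 = (\<lambda>_. \<gamma> * \<delta> / 2)"
    "Omega e1 e1 = (\<lambda>_. 0)" "Omega e2 e2 = (\<lambda>_. 0)"
    \<comment> \<open>Scaling by 0 provides \<open>omega 0\<close>, which occurs in
      \<open>Omega e1 e1\<close> and \<open>Omega e2 e2\<close>.\<close>
    using alpha_gamma omega_simps(4)[of e1 0]
    by (simp_all add: Omega_def omega_frame bracket_frame bracket_frame_swap omega_simps k_def
        fun_eq_iff power2_eq_square field_simps)
  then show "Ric e1 e1 = (\<lambda>_. - k)" "Ric e2 e2 = (\<lambda>_. - k)" "Ric e3 e3 = (\<lambda>_. 0)"
    "Ric e1 e2 = (\<lambda>_. 0)" "Ric e2 e1 = (\<lambda>_. 0)"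
    "Ric e1 e3 = (\<lambda>_. - \<gamma> * \<delta> / 4)" "Ric e3 e1 = (\<lambda>_. - \<gamma> * \<delta> / 4)"
    "Ric e2 e3 = (\<lambda>_. k / 2)" "Ric e3 e2 = (\<lambda>_. k / 2)"
    by (simp_all add: symmetrization_def ricci_frame)
qed

lemma tensor2_Ric: "tensor2 Ric"
  by (intro tensor2_symmetrization tensor2_ricci canonical.connection_manifold_axioms frame_closed)

lemma collineation_iff:
  fixes a b c
  assumes nonunimodular: "\<alpha> + \<delta> \<noteq> 0"
  defines "\<xi> \<equiv> a \<odot> e1 + b \<odot> e2 + c \<odot> e3"
  shows "(\<forall>X\<in>vector_fields A. \<forall>Y\<in>vector_fields A. \<forall>p. lie_derivative \<xi> Ric X Y p = 0) \<longleftrightarrow>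
    \<alpha> = 0 \<and> \<gamma> = 0 \<or> \<alpha> = 0 \<and> \<beta> = 0 \<and> b = 0 \<and> c = 0 \<or>
    \<alpha> \<noteq> 0 \<and> \<delta> = 0 \<and> a = 0 \<and> b = c \<or> a = 0 \<and> b = 0 \<and> c = 0"
proof -
  define k where "k = \<alpha>\<^sup>2 + \<beta> * \<gamma> / 2"
  have [simp]: "\<xi> \<in> vector_fields A" by (simp add: \<xi>_def)
  \<comment> \<open>Only two independent brackets occur, because
    \<open>[e1, e2] = - [e1, e3]\<close>; this is the origin of the factor
    \<open>b - c\<close>.\<close>
  have brackets: "lie_bracket \<xi> e1 = (b - c) \<odot> (\<alpha> \<odot> e1 + \<beta> \<odot> e2 + \<beta> \<odot> e3)"
    "lie_bracket \<xi> e2 = (- a) \<odot> (\<alpha> \<odot> e1 + \<beta> \<odot> e2 + \<beta> \<odot> e3) - c \<odot> (\<gamma> \<odot> e1 + \<delta> \<odot> e2 + \<delta> \<odot> e3)"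
    "lie_bracket \<xi> e3 = a \<odot> (\<alpha> \<odot> e1 + \<beta> \<odot> e2 + \<beta> \<odot> e3) + b \<odot> (\<gamma> \<odot> e1 + \<delta> \<odot> e2 + \<delta> \<odot> e3)"
    by (simp_all add: \<xi>_def lie_bracket_add_left lie_bracket_vscale_left bracket_frame_swap
        bracket_frame, simp_all add: fun_eq_iff vscale_def fscale_def tscale_def algebra_simps)
  have alpha_gamma': "\<alpha> * (\<gamma> * x) = 0" "\<alpha> * (\<beta> * (\<gamma> * x)) = 0" for x
    using alpha_gamma by auto
  have frame: "(\<forall>X\<in>vector_fields A. \<forall>Y\<in>vector_fields A. \<forall>p. lie_derivative \<xi> Ric X Y p = 0) \<longleftrightarrow>
    (\<forall>X\<in>{e1, e2, e3}. \<forall>Y\<in>{e1, e2, e3}. lie_derivative \<xi> Ric X Y = (\<lambda>_. 0))"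
    by (intro tensor2_zero_iff tensor2_lie_derivative tensor2_Ric) simp
  \<comment> \<open>\<open>Ric\<close> is constant on the frame, so the derivative along \<xi> drops
    out and only the two bracket terms contribute. By symmetry these six components suffice.\<close>
  have components:
    "lie_derivative \<xi> Ric e1 e1 = (\<lambda>_. 2 * ((b - c) * (\<alpha> * k + \<beta> * \<gamma> * \<delta> / 4)))"
    "lie_derivative \<xi> Ric e1 e2 = (\<lambda>_. (b - c) * \<beta> * k / 2
      - a * (\<alpha> * k + \<beta> * \<gamma> * \<delta> / 4) - c * (\<gamma> * k + \<gamma> * \<delta>\<^sup>2 / 4))"
    "lie_derivative \<xi> Ric e1 e3 = (\<lambda>_. - (b - c) * \<beta> * k / 2
      + a * (\<alpha> * k + \<beta> * \<gamma> * \<delta> / 4) + b * (\<gamma> * k + \<gamma> * \<delta>\<^sup>2 / 4))"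
    "lie_derivative \<xi> Ric e2 e2 = (\<lambda>_. - ((\<beta> * a + \<delta> * c) * k))"
    "lie_derivative \<xi> Ric e2 e3 = (\<lambda>_. a * \<beta> * k
      + c * (\<delta> * k / 2 - \<gamma>\<^sup>2 * \<delta> / 4) + b * \<delta> * k / 2)"
    "lie_derivative \<xi> Ric e3 e3 = (\<lambda>_. - (a * \<beta> * k + b * (\<delta> * k - \<gamma>\<^sup>2 * \<delta> / 2)))"
    by (simp_all add: lie_derivative_def brackets tensor2D[OF tensor2_Ric] Ric_frame
        k_def)
       (use alpha_gamma in \<open>auto simp: fun_eq_iff power2_eq_square alpha_gamma' field_simps\<close>)
  have sym: "lie_derivative \<xi> Ric Y X = lie_derivative \<xi> Ric X Y" for X Y
    by (simp add: lie_derivative_def symmetrization_def add.commute fun_eq_iff)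
  have double: "2 * x = 0 \<longleftrightarrow> x = 0" for x :: real by simp
  have "(\<forall>X\<in>vector_fields A. \<forall>Y\<in>vector_fields A. \<forall>p. lie_derivative \<xi> Ric X Y p = 0) \<longleftrightarrow>
      (b - c) * (\<alpha> * k + \<beta> * \<gamma> * \<delta> / 4) = 0 \<and>
      (b - c) * \<beta> * k / 2 - a * (\<alpha> * k + \<beta> * \<gamma> * \<delta> / 4) - c * (\<gamma> * k + \<gamma> * \<delta>\<^sup>2 / 4) = 0 \<and>
      - (b - c) * \<beta> * k / 2 + a * (\<alpha> * k + \<beta> * \<gamma> * \<delta> / 4) + b * (\<gamma> * k + \<gamma> * \<delta>\<^sup>2 / 4) = 0 \<and>
      (\<beta> * a + \<delta> * c) * k = 0 \<and>
      a * \<beta> * k + c * (\<delta> * k / 2 - \<gamma>\<^sup>2 * \<delta> / 4) + b * \<delta> * k / 2 = 0 \<and>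
      a * \<beta> * k + b * (\<delta> * k - \<gamma>\<^sup>2 * \<delta> / 2) = 0"
    unfolding frame
    by (simp only: ball_simps components sym[of e2 e1] sym[of e3 e1] sym[of e3 e2] fun_eq_iff
        double neg_equal_0_iff_equal simp_thms) blast
  then show ?thesis
    unfolding k_def using collineation_equations_iff[OF nonunimodular alpha_gamma] by simp
qed

end

section \<open>The space of collineations in terms of coefficients\<close>

theorem theorem4p17:
  fixes A :: "('g::{topological_group_add, t2_space, second_countable_topology}, real ^ 3) atlas"
    and g :: "'g \<Rightarrow> 'g tvec \<Rightarrow> 'g tvec \<Rightarrow> real"
    and J :: "'g \<Rightarrow> 'g tvec \<Rightarrow> 'g tvec"
    and nabla :: "'g vfield \<Rightarrow> 'g vfield \<Rightarrow> 'g vfield"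
    and e1 e2 e3 :: "'g vfield"
    and \<alpha> \<beta> \<gamma> \<delta> :: real
    and V :: "'g vfield set"
  assumes "\<alpha> + \<delta> \<noteq> 0" and "\<alpha> * \<gamma> = 0"
    and "lie_group A" and "connected (UNIV :: 'g set)"
    and "lorentzian_metric A g" and "left_invariant_metric A g"
    and "lie_algebra_basis A e1 e2 e3" and "pseudo_orthonormal g e1 e2 e3"
    and "lie_bracket e1 e2 = (- \<alpha>) \<odot> e1 - \<beta> \<odot> e2 - \<beta> \<odot> e3"
    and "lie_bracket e1 e3 = \<alpha> \<odot> e1 + \<beta> \<odot> e2 + \<beta> \<odot> e3"
    and "lie_bracket e2 e3 = \<gamma> \<odot> e1 + \<delta> \<odot> e2 + \<delta> \<odot> e3"
    and "product_structure A J" and "left_invariant_endo A J"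
    and "apply_field J e1 = e1" and "apply_field J e2 = e2" and "apply_field J e3 = - e3"
    and "levi_civita A g nabla"
    and "V = ricci_collineations A g (canonical_connection nabla J) e1 e2 e3"
  shows "((\<exists>\<xi>\<in>V. \<xi> \<noteq> 0) \<longleftrightarrow>
            (\<alpha> = 0 \<and> \<delta> \<noteq> 0 \<and> \<gamma> \<noteq> 0 \<and> \<beta> = 0) \<or>
            (\<alpha> = 0 \<and> \<delta> \<noteq> 0 \<and> \<gamma> = 0) \<or>
            (\<alpha> \<noteq> 0 \<and> \<gamma> = 0 \<and> \<delta> = 0)) \<and>
         (\<alpha> = 0 \<and> \<delta> \<noteq> 0 \<and> \<gamma> \<noteq> 0 \<and> \<beta> = 0 \<longrightarrow> V = vfield.span {e1}) \<and>
         (\<alpha> = 0 \<and> \<delta> \<noteq> 0 \<and> \<gamma> = 0 \<longrightarrow> V = vfield.span {e1, e2, e3}) \<and>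
         (\<alpha> \<noteq> 0 \<and> \<gamma> = 0 \<and> \<delta> = 0 \<longrightarrow> V = vfield.span {e2 + e3})"
proof -
  have basis: "vfield.span {e1, e2, e3} = left_invariant_fields A"
    using assms(7) by (simp add: lie_algebra_basis_def)
  \<comment> \<open>Frame fields lie in their own span, hence are left-invariant and in particular
    smooth fields.\<close>
  have "e \<in> vector_fields A" if "e \<in> {e1, e2, e3}" for e
    using vfield.span_base[OF that] unfolding basis by (simp add: left_invariant_fields_def)
  then interpret g7_frame A g nabla J e1 e2 e3 \<alpha> \<beta> \<gamma> \<delta>
    by unfold_locales (use assms in \<open>simp_all add: lie_group_def\<close>)
  \<comment> \<open>The solution set of the collineation equations; the last disjunct is the trivial
    solution.\<close>
  define R where "R a b c \<longleftrightarrow> \<alpha> = 0 \<and> \<gamma> = 0 \<or> \<alpha> = 0 \<and> \<beta> = 0 \<and> b = 0 \<and> c = 0 \<or>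
    \<alpha> \<noteq> 0 \<and> \<delta> = 0 \<and> a = 0 \<and> b = c \<or> a = 0 \<and> b = 0 \<and> c = 0" for a b c :: real
  have span3: "vfield.span {e1, e2, e3} = {a \<odot> e1 + b \<odot> e2 + c \<odot> e3 | a b c. True}"
    by (auto simp: vfield.span_insert vfield.span_empty algebra_simps)
  have V: "V = {a \<odot> e1 + b \<odot> e2 + c \<odot> e3 | a b c. R a b c}"
  proof -
    have "V = {a \<odot> e1 + b \<odot> e2 + c \<odot> e3 | a b c. \<forall>X\<in>vector_fields A. \<forall>Y\<in>vector_fields A. \<forall>p.
        lie_derivative (a \<odot> e1 + b \<odot> e2 + c \<odot> e3) Ric X Y p = 0}"
      unfolding assms(18) ricci_collineations_def basis[symmetric] span3 by auto
    then show ?thesis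
      by (simp only: collineation_iff[OF assms(1)] R_def)
  qed
  \<comment> \<open>Written as a frame combination, 0 can be compared with members of
    \<open>V\<close> by uniqueness of coefficients.\<close>
  have zero: "0 = 0 \<odot> e1 + 0 \<odot> e2 + 0 \<odot> e3" by simp
  have "(\<exists>\<xi>\<in>V. \<xi> \<noteq> 0) \<longleftrightarrow> (\<exists>a b c. R a b c \<and> \<not> (a = 0 \<and> b = 0 \<and> c = 0))"
    unfolding V zero using frame_combination_eq_iff[of _ _ _ 0 0 0] by blast
  also have "\<dots> \<longleftrightarrow> \<alpha> = 0 \<and> (\<gamma> = 0 \<or> \<beta> = 0) \<or> \<alpha> \<noteq> 0 \<and> \<delta> = 0"
    (is "?L \<longleftrightarrow> ?R")
  proof
    assume ?R
    \<comment> \<open>The witnesses are \<open>e1\<close> if \<alpha> = 0 and \<open>e2 + e3\<close>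
      otherwise.\<close>
    then have "R 1 0 0 \<or> R 0 1 1" by (auto simp: R_def)
    then show ?L by (metis zero_neq_one)
  qed (auto simp: R_def)
  also have "\<dots> \<longleftrightarrow> (\<alpha> = 0 \<and> \<delta> \<noteq> 0 \<and> \<gamma> \<noteq> 0 \<and> \<beta> = 0) \<or> (\<alpha> = 0 \<and> \<delta> \<noteq> 0 \<and> \<gamma> = 0) \<or>
      (\<alpha> \<noteq> 0 \<and> \<gamma> = 0 \<and> \<delta> = 0)"
    \<comment> \<open>If \<alpha> = 0, then \<delta> is nonzero since \<alpha> + \<delta> is; if
      \<alpha> is nonzero, \<alpha>\<gamma> = 0 gives \<gamma> = 0.\<close>
    using assms(1,2) by auto
  finally have nonzero: "(\<exists>\<xi>\<in>V. \<xi> \<noteq> 0) \<longleftrightarrow> (\<alpha> = 0 \<and> \<delta> \<noteq> 0 \<and> \<gamma> \<noteq> 0 \<and> \<beta> = 0) \<or>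
      (\<alpha> = 0 \<and> \<delta> \<noteq> 0 \<and> \<gamma> = 0) \<or> (\<alpha> \<noteq> 0 \<and> \<gamma> = 0 \<and> \<delta> = 0)" .
  moreover have "V = vfield.span {e1}" if "\<alpha> = 0" "\<gamma> \<noteq> 0" "\<beta> = 0"
  proof -
    have "R a b c \<longleftrightarrow> b = 0 \<and> c = 0" for a b c
      using that by (auto simp: R_def)
    then show ?thesis by (auto simp: V vfield.span_singleton)
  qed
  moreover have "V = vfield.span {e1, e2, e3}" if "\<alpha> = 0" "\<gamma> = 0"
    using that by (simp add: V R_def span3)
  moreover have "V = vfield.span {e2 + e3}" if "\<alpha> \<noteq> 0" "\<delta> = 0"
  proof -
    have "R a b c \<longleftrightarrow> a = 0 \<and> b = c" for a b c
      using that by (auto simp: R_def)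
    then show ?thesis by (auto simp: V vfield.span_singleton vfield.scale_right_distrib)
  qed
  ultimately show ?thesis by blast
qed

end
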